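(* Let $\delta\in(0,1)$ and $\overline\gamma_\delta:=\inf\{\gamma\in[0,1]:\overline{\mathfrak D}_\delta(\gamma)\le0\}$, with $\inf\varnothing:=+\infty$. With probability at least $1-\delta$, $\gamma_{s,\lambda}^\star(P,Q)\le\overline\gamma_\delta$ and, whenever $\overline\gamma_\delta<\infty$, $P\preceq_{s,\lambda,\gamma}^{\rm CSD}Q$ for every $\gamma\in[\overline\gamma_\delta,1]$.
   Context: Let $D\subseteq\mathbb R^d$ be a nonempty Borel set; $P,Q$ are Borel probability measures supported on $D$ with finite first moments, and moreover supported on known sets $D_P,D_Q\subseteq D$, respectively (i.e. $P(D_P)=Q(D_Q)=1$). $\mathcal C(P,Q)$ is the set of couplings of $P$ and $Q$, and $t_+:=\max\{t,0\}$. Let $(\Theta,\mathscr A,\lambda)$ be a finite measure space and $s:\Theta\times\mathbb R^d\to\mathbb R$ jointly measurable; $s_\theta(x):=s(\theta,x)$. Standing assumptions: each $s_\theta$ is coordinatewise nondecreasing, $\int_\Theta|s_\theta(0)|\,\lambda(d\theta)<\infty$, and for some finite $\overline L_s$, $\int_\Theta|s_\theta(x)-s_\theta(y)|\,\lambda(d\theta)\le\overline L_s\|x-y\|_1$ for all $x,y\in\mathbb R^d$. Define $S(x):=\int_\Theta s_\theta(x)\,\lambda(d\theta)$, $\ell_s(x,y):=\int_\Theta(s_\theta(x)-s_\theta(y))_+\,\lambda(d\theta)$, $L_s^\star(P,Q):=\inf_{\kappa\in\mathcal C(P,Q)}\int\ell_s(x,y)\,\kappa(dx,dy)$. CSD: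 for $\gamma\in[0,1]$, $P\preceq_{s,\lambda,\gamma}^{\rm CSD}Q$ means that there is $\kappa\in\mathcal C(P,Q)$ with $\int\ell_s(x,y)\,\kappa(dx,dy)\le\gamma\int\ell_s(y,x)\,\kappa(dx,dy)$. The smallest tolerance is $\gamma_{s,\lambda}^\star(P,Q):=\inf\{\gamma\in[0,1]:P\preceq_{s,\lambda,\gamma}^{\rm CSD}Q\}$, with $\inf\varnothing:=+\infty$. Samples: $X_1,\ldots,X_{N_P}$ i.i.d. from $P$ and $Y_1,\ldots,Y_{N_Q}$ i.i.d. from $Q$, the two samples independent; $\widehat P_{N_P}:=\frac1{N_P}\sum_i\delta_{X_i}$, $\widehat Q_{N_Q}:=\frac1{N_Q}\sum_j\delta_{Y_j}$, $\widehat\Delta_s:=\frac1{N_Q}\sum_jS(Y_j)-\frac1{N_P}\sum_iS(X_i)$, $\widehat L_s^\star:=L_s^\star(\widehat P_{N_P},\widehat Q_{N_Q})$. Constants, assumed finite: $c_P^L:=\sup_{x,x'\in D_P,\,y\in D_Q}|\ell_s(x,y)-\ell_s(x',y)|$, $c_Q^L:=\sup_{x\in D_P,\,y,y'\in D_Q}|\ell_s(x,y)-\ell_s(x,y')|$, $c_P^S:=\sup_{x,x'\in D_P}|S(x)-S(x')|$, $c_Q^S:=\sup_{y,y'\in D_Q}|S(y)-S(y')|$. Bounds: $$\overline L_\delta:=\widehat L_s^\star+\sqrt{\tfrac{\log(2/\delta)}{2}\Big(\tfrac{(c_P^L)^2}{N_P}+\tfrac{(c_Q^L)^2}{N_Q}\Big)},\qquad\underline\Delta_\delta:=\widehat\Delta_s-\sqrt{\tfrac{\log(2/\delta)}{2}\Big(\tfrac{(c_P^S)^2}{N_P}+\tfrac{(c_Q^S)^2}{N_Q}\Big)},$$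 $$\overline{\mathfrak D}_\delta(\gamma):=(1-\gamma)\overline L_\delta-\gamma\,\underline\Delta_\delta,\quad\gamma\in[0,1].$$ *)

theory Defs
  imports "HOL-Probability.Probability"
begin

definition l1_norm :: "real ^ 'n \<Rightarrow> real" where
  "l1_norm x = (\<Sum>i\<in>UNIV. \<bar>x $ i\<bar>)"

definition couplings :: "'a measure \<Rightarrow> 'b measure \<Rightarrow> ('a \<times> 'b) measure set" where
  "couplings P Q =
    {\<kappa>. sets \<kappa> = sets (P \<Otimes>\<^sub>M Q) \<and> distr \<kappa> P fst = P \<and> distr \<kappa> Q snd = Q}"

text \<open>The order on \<^typ>\<open>real ^ 'n\<close> is the componentwise one, so \<^const>\<open>mono\<close> says
  coordinatewise nondecreasing. The integrals are stated in \<^typ>\<open>ennreal\<close> because a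
  non-integrable function has Bochner integral 0; finiteness of both makes every
  \<open>s \<theta> x\<close> integrable in \<open>\<theta>\<close>, so the Bochner integrals below are the intended ones.\<close>

definition score_family :: "'t measure \<Rightarrow> ('t \<Rightarrow> real ^ 'n \<Rightarrow> real) \<Rightarrow> bool" where
  "score_family lam s \<longleftrightarrow>
     finite_measure lam \<and>
     (\<lambda>(\<theta>, x). s \<theta> x) \<in> borel_measurable (lam \<Otimes>\<^sub>M borel) \<and>
     (\<forall>\<theta>\<in>space lam. mono (s \<theta>)) \<and>
     (\<integral>\<^sup>+\<theta>. ennreal \<bar>s \<theta> 0\<bar> \<partial>lam) < \<infinity> \<and>
     (\<exists>L\<ge>0. \<forall>x y. (\<integral>\<^sup>+\<theta>. ennreal \<bar>s \<theta> x - s \<theta> y\<bar> \<partial>lam) \<le> ennreal (L * l1_norm (x - y)))"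

definition agg_score :: "'t measure \<Rightarrow> ('t \<Rightarrow> 'a \<Rightarrow> real) \<Rightarrow> 'a \<Rightarrow> real" where
  "agg_score lam s x = (\<integral>\<theta>. s \<theta> x \<partial>lam)"

definition loss :: "'t measure \<Rightarrow> ('t \<Rightarrow> 'a \<Rightarrow> real) \<Rightarrow> 'a \<Rightarrow> 'a \<Rightarrow> real" where
  "loss lam s x y = (\<integral>\<theta>. max (s \<theta> x - s \<theta> y) 0 \<partial>lam)"

text \<open>Since \<open>0 \<le> loss lam s x y \<le> L * l1_norm (x - y)\<close>, the loss is integrable under every
  coupling of measures with finite first moments.\<close>

definition opt_loss ::
  "'t measure \<Rightarrow> ('t \<Rightarrow> 'a \<Rightarrow> real) \<Rightarrow> 'a measure \<Rightarrow> 'a measure \<Rightarrow> real" where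
  "opt_loss lam s P Q = (INF \<kappa>\<in>couplings P Q. \<integral>(x, y). loss lam s x y \<partial>\<kappa>)"

definition csd ::
  "'t measure \<Rightarrow> ('t \<Rightarrow> 'a \<Rightarrow> real) \<Rightarrow> real \<Rightarrow> 'a measure \<Rightarrow> 'a measure \<Rightarrow> bool" where
  "csd lam s \<gamma> P Q \<longleftrightarrow>
     (\<exists>\<kappa>\<in>couplings P Q.
        (\<integral>(x, y). loss lam s x y \<partial>\<kappa>) \<le> \<gamma> * (\<integral>(x, y). loss lam s y x \<partial>\<kappa>))"

text \<open>Tolerances live in \<^typ>\<open>ereal\<close>, where the infimum of the empty set is \<open>\<infinity>\<close>.\<close>

definition gamma_star ::
  "'t measure \<Rightarrow> ('t \<Rightarrow> 'a \<Rightarrow> real) \<Rightarrow> 'a measure \<Rightarrow> 'a measure \<Rightarrow> ereal" where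
  "gamma_star lam s P Q = Inf (ereal ` {\<gamma>\<in>{0..1}. csd lam s \<gamma> P Q})"

definition empirical :: "nat \<Rightarrow> (nat \<Rightarrow> 'a::topological_space) \<Rightarrow> 'a measure" where
  "empirical N x =
     measure_of UNIV (sets borel)
       (\<lambda>A. (\<Sum>i = 1..N. emeasure (return borel (x i)) A) / of_nat N)"

lemma sets_empirical [simp]: "sets (empirical N x) = sets borel"
  unfolding empirical_def
  using sets.sigma_sets_eq[of "borel :: 'a measure"] by simp

lemma emeasure_empirical:
  assumes "A \<in> sets borel"
  shows "emeasure (empirical N x) A = (\<Sum>i = 1..N. emeasure (return borel (x i)) A) / of_nat N"
proof (rule emeasure_measure_of[OF empirical_def])
  show "sets borel \<subseteq> Pow UNIV" by simp
  show "A \<in> sets (empirical N x)" using assms by simp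
  let ?f = "\<lambda>A. (\<Sum>i = 1..N. emeasure (return borel (x i)) A) / of_nat N"
  show "positive (sets (empirical N x)) ?f"
    by (simp add: positive_def)
  show "countably_additive (sets (empirical N x)) ?f"
  proof (rule countably_additiveI)
    fix B :: "nat \<Rightarrow> 'a set"
    assume B: "range B \<subseteq> sets (empirical N x)" "disjoint_family B"
    have "(\<Sum>k. emeasure (return borel (x i)) (B k)) = emeasure (return borel (x i)) (\<Union>k. B k)" for i
      using B by (intro suminf_emeasure) auto
    then have "(\<Sum>i = 1..N. emeasure (return borel (x i)) (\<Union>k. B k))
        = (\<Sum>k. \<Sum>i = 1..N. emeasure (return borel (x i)) (B k))"
      by (simp add: suminf_sum)
    then show "(\<Sum>k. ?f (B k)) = ?f (\<Union>k. B k)"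
      by (simp add: divide_ennreal_def)
  qed
qed

definition mean_gap_hat ::
  "'t measure \<Rightarrow> ('t \<Rightarrow> 'a \<Rightarrow> real) \<Rightarrow> nat \<Rightarrow> nat \<Rightarrow> (nat \<Rightarrow> 'a) \<Rightarrow> (nat \<Rightarrow> 'a) \<Rightarrow> real" where
  "mean_gap_hat lam s NP NQ x y =
     (\<Sum>j = 1..NQ. agg_score lam s (y j)) / real NQ - (\<Sum>i = 1..NP. agg_score lam s (x i)) / real NP"

definition opt_loss_hat ::
  "'t measure \<Rightarrow> ('t \<Rightarrow> 'a::topological_space \<Rightarrow> real) \<Rightarrow> nat \<Rightarrow> nat
     \<Rightarrow> (nat \<Rightarrow> 'a) \<Rightarrow> (nat \<Rightarrow> 'a) \<Rightarrow> real" where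
  "opt_loss_hat lam s NP NQ x y = opt_loss lam s (empirical NP x) (empirical NQ y)"

definition loss_diffs_P ::
  "'t measure \<Rightarrow> ('t \<Rightarrow> 'a \<Rightarrow> real) \<Rightarrow> 'a set \<Rightarrow> 'a set \<Rightarrow> real set" where
  "loss_diffs_P lam s DP DQ =
     {\<bar>loss lam s x y - loss lam s x' y\<bar> | x x' y. x \<in> DP \<and> x' \<in> DP \<and> y \<in> DQ}"

definition loss_diffs_Q ::
  "'t measure \<Rightarrow> ('t \<Rightarrow> 'a \<Rightarrow> real) \<Rightarrow> 'a set \<Rightarrow> 'a set \<Rightarrow> real set" where
  "loss_diffs_Q lam s DP DQ =
     {\<bar>loss lam s x y - loss lam s x y'\<bar> | x y y'. x \<in> DP \<and> y \<in> DQ \<and> y' \<in> DQ}"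

definition score_diffs :: "'t measure \<Rightarrow> ('t \<Rightarrow> 'a \<Rightarrow> real) \<Rightarrow> 'a set \<Rightarrow> real set" where
  "score_diffs lam s A = {\<bar>agg_score lam s x - agg_score lam s x'\<bar> | x x'. x \<in> A \<and> x' \<in> A}"

definition loss_upper ::
  "'t measure \<Rightarrow> ('t \<Rightarrow> 'a::topological_space \<Rightarrow> real) \<Rightarrow> 'a set \<Rightarrow> 'a set \<Rightarrow> nat \<Rightarrow> nat
     \<Rightarrow> real \<Rightarrow> (nat \<Rightarrow> 'a) \<Rightarrow> (nat \<Rightarrow> 'a) \<Rightarrow> real" where
  "loss_upper lam s DP DQ NP NQ \<delta> x y =
     opt_loss_hat lam s NP NQ x y +
     sqrt (ln (2 / \<delta>) / 2 *
       ((Sup (loss_diffs_P lam s DP DQ))\<^sup>2 / real NP + (Sup (loss_diffs_Q lam s DP DQ))\<^sup>2 / real NQ))"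

definition gap_lower ::
  "'t measure \<Rightarrow> ('t \<Rightarrow> 'a \<Rightarrow> real) \<Rightarrow> 'a set \<Rightarrow> 'a set \<Rightarrow> nat \<Rightarrow> nat
     \<Rightarrow> real \<Rightarrow> (nat \<Rightarrow> 'a) \<Rightarrow> (nat \<Rightarrow> 'a) \<Rightarrow> real" where
  "gap_lower lam s DP DQ NP NQ \<delta> x y =
     mean_gap_hat lam s NP NQ x y -
     sqrt (ln (2 / \<delta>) / 2 *
       ((Sup (score_diffs lam s DP))\<^sup>2 / real NP + (Sup (score_diffs lam s DQ))\<^sup>2 / real NQ))"

definition deficit_upper ::
  "'t measure \<Rightarrow> ('t \<Rightarrow> 'a::topological_space \<Rightarrow> real) \<Rightarrow> 'a set \<Rightarrow> 'a set \<Rightarrow> nat \<Rightarrow> nat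
     \<Rightarrow> real \<Rightarrow> (nat \<Rightarrow> 'a) \<Rightarrow> (nat \<Rightarrow> 'a) \<Rightarrow> real \<Rightarrow> real" where
  "deficit_upper lam s DP DQ NP NQ \<delta> x y \<gamma> =
     (1 - \<gamma>) * loss_upper lam s DP DQ NP NQ \<delta> x y - \<gamma> * gap_lower lam s DP DQ NP NQ \<delta> x y"

definition gamma_upper ::
  "'t measure \<Rightarrow> ('t \<Rightarrow> 'a::topological_space \<Rightarrow> real) \<Rightarrow> 'a set \<Rightarrow> 'a set \<Rightarrow> nat \<Rightarrow> nat
     \<Rightarrow> real \<Rightarrow> (nat \<Rightarrow> 'a) \<Rightarrow> (nat \<Rightarrow> 'a) \<Rightarrow> ereal" where
  "gamma_upper lam s DP DQ NP NQ \<delta> x y =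
     Inf (ereal ` {\<gamma>\<in>{0..1}. deficit_upper lam s DP DQ NP NQ \<delta> x y \<gamma> \<le> 0})"

definition iid_sample :: "'w measure \<Rightarrow> nat \<Rightarrow> (nat \<Rightarrow> 'w \<Rightarrow> 'a) \<Rightarrow> 'a measure \<Rightarrow> bool" where
  "iid_sample M N X P \<longleftrightarrow>
     prob_space.indep_vars M (\<lambda>_. P) X {1..N} \<and> (\<forall>i\<in>{1..N}. distr M P (X i) = P)"

definition indep_samples ::
  "'w measure \<Rightarrow> nat \<Rightarrow> (nat \<Rightarrow> 'w \<Rightarrow> 'a) \<Rightarrow> 'a measure
     \<Rightarrow> nat \<Rightarrow> (nat \<Rightarrow> 'w \<Rightarrow> 'a) \<Rightarrow> 'a measure \<Rightarrow> bool" where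
  "indep_samples M NP X P NQ Y Q \<longleftrightarrow>
     prob_space.indep_var M
       (\<Pi>\<^sub>M i\<in>{1..NP}. P) (\<lambda>\<omega>. \<lambda>i\<in>{1..NP}. X i \<omega>)
       (\<Pi>\<^sub>M j\<in>{1..NQ}. Q) (\<lambda>\<omega>. \<lambda>j\<in>{1..NQ}. Y j \<omega>)"

end

theory Submission
  imports Defs
begin

text \<open>
  Every coupling \<open>\<kappa>\<close> of \<open>P\<close> and \<open>Q\<close> has \<open>\<integral>\<ell>(y,x) d\<kappa> = \<integral>\<ell>(x,y) d\<kappa> + \<Delta>\<close> with
  \<open>\<Delta> = \<integral>S dQ - \<integral>S dP\<close>, so dominance at tolerance \<open>\<gamma>\<close> says \<open>(1 - \<gamma>) \<integral>\<ell> d\<kappa> \<le> \<gamma> \<Delta>\<close> for some \<open>\<kappa>\<close>.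
  It therefore suffices that, with probability \<open>1 - \<delta>\<close>, some coupling costs at most the upper bound
  on the loss and \<open>\<Delta>\<close> is at least its lower bound. Both follow from McDiarmid's inequality, once
  the optimal loss is known to be at most the expected empirical optimal loss: mixing
  near-optimal empirical transport plans over the sample gives a coupling of \<open>P\<close> and \<open>Q\<close>.
  The tail bound holds with strict inequality, so no optimal coupling of \<open>P\<close> and \<open>Q\<close> has to exist.
\<close>

section \<open>McDiarmid's inequality\<close>

text \<open>The empirical optimal loss is an infimum over couplings that vary with the sample.
  Rewriting it as a finite transport problem moves the sample into the cost matrix and leaves the
  feasible set \<open>plans\<close> fixed. This settles three points: exchanging one sample alters
  one row or column, of total mass 1/N, which gives the bounded differences; a countable dense set
  of plans reduces the infimum to countably many measurable costs; and the same dense set permits a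
  measurable choice of near-optimal plans, so that mixing them over the sample space makes sense.
  The tail bound concerns the mean of the empirical loss, which may exceed the optimal loss of
  \<open>P\<close> and \<open>Q\<close>. This bias is harmless, as it goes in the direction that an
  upper bound tolerates. Each bound may fail with probability \<delta>/2, hence the logarithm of
  2/\<delta> in the radii. A radius of 0 needs its own argument, since the tail bound at t = 0 says
  nothing; it occurs exactly when the relevant oscillations vanish, and then the empirical quantity
  is almost surely constant.\<close>

lemma (in prob_space) mgf_oscillation:
  fixes f :: "'a \<Rightarrow> real"
  assumes [measurable]: "f \<in> borel_measurable M"
    and osc: "\<And>x y. x \<in> space M \<Longrightarrow> y \<in> space M \<Longrightarrow> \<bar>f x - f y\<bar> \<le> c"
    and "0 < l"
  shows "(\<integral>\<^sup>+x. ennreal (exp (l * (f x - expectation f))) \<partial>M) \<le> ennreal (exp (l\<^sup>2 * c\<^sup>2 / 8))"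
proof -
  obtain x0 where x0: "x0 \<in> space M" using not_empty by auto
  \<comment> \<open>Hoeffding's lemma is applied on [inf f, sup f], whose length is at most
    \<open>c\<close>. The interval of radius \<open>c\<close> around a single value has length 2c
    and would lose a factor 4 in the exponent; it only serves to show that \<open>f\<close> is
    bounded.\<close>
  define a where "a = (INF x\<in>space M. f x)"
  define b where "b = (SUP x\<in>space M. f x)"
  have bd: "f x0 - c \<le> f x" "f x \<le> f x0 + c" if "x \<in> space M" for x
    using osc[OF that x0] by auto
  have below: "bdd_below (f ` space M)" and above: "bdd_above (f ` space M)"
    using bd by (auto intro!: bdd_belowI2 bdd_aboveI2)
  have ab: "a \<le> f x" "f x \<le> b" if "x \<in> space M" for x
    using that below above by (auto simp: a_def b_def intro: cINF_lower cSUP_upper)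
  have "b \<le> f y + c" if "y \<in> space M" for y
    unfolding b_def using x0 osc[OF _ that] by (intro cSUP_least) (auto simp: abs_le_iff algebra_simps)
  hence "b - c \<le> a"
    unfolding a_def using x0 by (intro cINF_greatest) (auto simp: algebra_simps)
  moreover have "a \<le> b" using ab[OF x0] by simp
  ultimately have sq: "(b - a)\<^sup>2 \<le> c\<^sup>2" by (intro power_mono) auto
  interpret interval_bounded_random_variable M f a b
    by unfold_locales (use ab in auto)
  have "(\<integral>\<^sup>+x. ennreal (exp (l * (f x - expectation f))) \<partial>M)
      \<le> ennreal (exp (l\<^sup>2 * (b - a)\<^sup>2 / 8))"
    using Hoeffdings_lemma_nn_integral[OF \<open>0 < l\<close>] by simp
  also have "\<dots> \<le> ennreal (exp (l\<^sup>2 * c\<^sup>2 / 8))"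
    using sq by (intro ennreal_leI) (auto intro!: mult_left_mono divide_right_mono)
  finally show ?thesis .
qed

text \<open>With \<open>F\<close> the mean of \<open>f\<close> over the second factor, f - E f = (f
  - F) + (F - E F). The second summand is constant for fixed first coordinate, so its exponential
  leaves the inner integral, which is at most \<open>exp a\<close> whatever that coordinate is. This
  takes the place of a martingale decomposition.\<close>

lemma mgf_pair:
  fixes f :: "'a \<times> 'b \<Rightarrow> real"
  assumes M: "prob_space M" and N: "prob_space N"
    and f[measurable]: "f \<in> borel_measurable (M \<Otimes>\<^sub>M N)"
    and bd: "\<And>z. z \<in> space (M \<Otimes>\<^sub>M N) \<Longrightarrow> \<bar>f z\<bar> \<le> B"
    and inner: "\<And>x. x \<in> space M \<Longrightarrow>
      (\<integral>\<^sup>+y. ennreal (exp (l * (f (x, y) - (\<integral>y. f (x, y) \<partial>N)))) \<partial>N) \<le> ennreal (exp a)"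
    and outer: "(\<integral>\<^sup>+x. ennreal (exp (l * ((\<integral>y. f (x, y) \<partial>N) - (\<integral>x. (\<integral>y. f (x, y) \<partial>N) \<partial>M)))) \<partial>M)
      \<le> ennreal (exp b)"
  shows "(\<integral>\<^sup>+z. ennreal (exp (l * (f z - integral\<^sup>L (M \<Otimes>\<^sub>M N) f))) \<partial>(M \<Otimes>\<^sub>M N)) \<le> ennreal (exp (a + b))"
proof -
  interpret M: prob_space M by fact
  interpret N: prob_space N by fact
  interpret P: pair_prob_space M N ..
  define F where "F = (\<lambda>x. \<integral>y. f (x, y) \<partial>N)"
  have F[measurable]: "F \<in> borel_measurable M" unfolding F_def by measurable
  have int: "integrable (M \<Otimes>\<^sub>M N) f"
    by (rule P.integrable_const_bound[where B = B]) (use bd in auto)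
  have E: "integral\<^sup>L (M \<Otimes>\<^sub>M N) f = integral\<^sup>L M F"
    unfolding F_def using P.integral_fst'[OF int] by simp
  have "(\<integral>\<^sup>+z. ennreal (exp (l * (f z - integral\<^sup>L M F))) \<partial>(M \<Otimes>\<^sub>M N))
      = (\<integral>\<^sup>+x. \<integral>\<^sup>+y. ennreal (exp (l * (f (x, y) - integral\<^sup>L M F))) \<partial>N \<partial>M)"
    by (subst N.nn_integral_fst[symmetric]) auto
  also have "\<dots> = (\<integral>\<^sup>+x. ennreal (exp (l * (F x - integral\<^sup>L M F)))
        * (\<integral>\<^sup>+y. ennreal (exp (l * (f (x, y) - F x))) \<partial>N) \<partial>M)"
    by (intro nn_integral_cong, subst nn_integral_cmult[symmetric])
       (auto simp: algebra_simps simp flip: ennreal_mult exp_add)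
  also have "\<dots> \<le> (\<integral>\<^sup>+x. ennreal (exp (l * (F x - integral\<^sup>L M F))) * ennreal (exp a) \<partial>M)"
    using inner by (intro nn_integral_mono mult_left_mono) (auto simp: F_def)
  also have "\<dots> = (\<integral>\<^sup>+x. ennreal (exp (l * (F x - integral\<^sup>L M F))) \<partial>M) * ennreal (exp a)"
    by (rule nn_integral_multc) auto
  also have "\<dots> \<le> ennreal (exp b) * ennreal (exp a)"
    using outer by (intro mult_right_mono) (auto simp: F_def)
  also have "\<dots> = ennreal (exp (a + b))"
    by (simp add: exp_add mult.commute flip: ennreal_mult)
  finally show ?thesis by (simp add: E)
qed

text \<open>Induction splits off coordinate \<open>i\<close> as the outer factor of
  \<open>mgf_pair\<close>. For a fixed value of it the remaining coordinates fall under the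
  induction hypothesis; the mean over them, as a function of coordinate \<open>i\<close> alone,
  still oscillates by at most \<open>c i\<close>, since averaging preserves such a bound.\<close>

lemma mgf_bounded_differences:
  fixes f :: "('i \<Rightarrow> 'a) \<Rightarrow> real"
  assumes "finite I" and "\<And>i. i \<in> I \<Longrightarrow> prob_space (M i)"
    and "f \<in> borel_measurable (Pi\<^sub>M I M)"
    and "\<And>x. x \<in> space (Pi\<^sub>M I M) \<Longrightarrow> \<bar>f x\<bar> \<le> B"
    and "\<And>x i u. x \<in> space (Pi\<^sub>M I M) \<Longrightarrow> i \<in> I \<Longrightarrow> u \<in> space (M i) \<Longrightarrow> \<bar>f (x(i := u)) - f x\<bar> \<le> c i"
    and l: "0 < l"
  shows "(\<integral>\<^sup>+x. ennreal (exp (l * (f x - integral\<^sup>L (Pi\<^sub>M I M) f))) \<partial>Pi\<^sub>M I M)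
    \<le> ennreal (exp (l\<^sup>2 * (\<Sum>i\<in>I. (c i)\<^sup>2) / 8))"
  using assms(1-5)
proof (induction I arbitrary: f rule: finite_induct)
  case empty
  interpret prob_space "Pi\<^sub>M {} M" by (rule prob_space_PiM) auto
  show ?case
    using mgf_oscillation[of f 0 l] empty l by (auto simp: space_PiM)
next
  case (insert i I)
  interpret Mi: prob_space "M i" using insert by auto
  interpret MI: prob_space "Pi\<^sub>M I M" using insert by (intro prob_space_PiM) auto
  let ?N = "M i \<Otimes>\<^sub>M Pi\<^sub>M I M"
  let ?h = "\<lambda>(u, x). x(i := u)"
  have h[measurable]: "?h \<in> measurable ?N (Pi\<^sub>M (insert i I) M)" by measurable
  have f[measurable]: "f \<in> borel_measurable (Pi\<^sub>M (insert i I) M)" by fact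
  have law: "distr ?N (Pi\<^sub>M (insert i I) M) ?h = Pi\<^sub>M (insert i I) M"
    using insert.prems(1) by (intro distr_pair_PiM_eq_PiM) auto
  define g where "g = (\<lambda>z. f (?h z))"
  have g[measurable]: "g \<in> borel_measurable ?N" unfolding g_def by measurable
  have upd: "x(i := u) \<in> space (Pi\<^sub>M (insert i I) M)"
    if "u \<in> space (M i)" "x \<in> space (Pi\<^sub>M I M)" for u x
    using measurable_space[OF h, of "(u, x)"] that by (auto simp: space_pair_measure)
  have gB: "\<bar>g z\<bar> \<le> B" if "z \<in> space ?N" for z
    using that insert.prems(3) upd by (auto simp: g_def space_pair_measure)
  have "(\<integral>\<^sup>+z. ennreal (exp (l * (g z - integral\<^sup>L ?N g))) \<partial>?N)
    \<le> ennreal (exp (l\<^sup>2 * (\<Sum>i\<in>I. (c i)\<^sup>2) / 8 + l\<^sup>2 * (c i)\<^sup>2 / 8))"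
  proof (rule mgf_pair[where B = B])
    fix u assume u: "u \<in> space (M i)"
    show "(\<integral>\<^sup>+x. ennreal (exp (l * (g (u, x) - (\<integral>x. g (u, x) \<partial>Pi\<^sub>M I M)))) \<partial>Pi\<^sub>M I M)
      \<le> ennreal (exp (l\<^sup>2 * (\<Sum>i\<in>I. (c i)\<^sup>2) / 8))"
    proof (rule insert.IH)
      fix x j v assume x: "x \<in> space (Pi\<^sub>M I M)" "j \<in> I" "v \<in> space (M j)"
      have "(x(j := v))(i := u) = (x(i := u))(j := v)"
        using x insert.hyps by (auto simp: fun_eq_iff)
      moreover have "\<bar>f ((x(i := u))(j := v)) - f (x(i := u))\<bar> \<le> c j"
        using insert.prems(4) upd[OF u x(1)] x by blast
      ultimately show "\<bar>g (u, x(j := v)) - g (u, x)\<bar> \<le> c j"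
        unfolding g_def by (simp only: prod.case)
    qed (use u gB insert.prems(1) in \<open>auto simp: space_pair_measure\<close>)
  next
    have int: "integrable (Pi\<^sub>M I M) (\<lambda>x. g (u, x))" if "u \<in> space (M i)" for u
      using that gB by (intro MI.integrable_const_bound[where B = B]) (auto simp: space_pair_measure)
    show "(\<integral>\<^sup>+u. ennreal (exp (l * ((\<integral>x. g (u, x) \<partial>Pi\<^sub>M I M)
        - (\<integral>u. (\<integral>x. g (u, x) \<partial>Pi\<^sub>M I M) \<partial>M i)))) \<partial>M i) \<le> ennreal (exp (l\<^sup>2 * (c i)\<^sup>2 / 8))"
    proof (rule Mi.mgf_oscillation)
      fix u v assume uv: "u \<in> space (M i)" "v \<in> space (M i)"
      have *: "\<bar>g (u, x) - g (v, x)\<bar> \<le> c i" if x: "x \<in> space (Pi\<^sub>M I M)" for x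
      proof -
        \<comment> \<open>The second update overwrites \<open>v\<close>, so this compares the values
          at \<open>u\<close> and at \<open>v\<close>. The detour is needed because \<open>x\<close>
          itself has no coordinate \<open>i\<close> and is not a point of the larger
          product.\<close>
        have "\<bar>f ((x(i := v))(i := u)) - f (x(i := v))\<bar> \<le> c i"
          using insert.prems(4) upd[OF uv(2) x] uv by blast
        thus ?thesis by (simp add: g_def)
      qed
      have "(\<integral>x. g (u, x) \<partial>Pi\<^sub>M I M) - (\<integral>x. g (v, x) \<partial>Pi\<^sub>M I M) = (\<integral>x. g (u, x) - g (v, x) \<partial>Pi\<^sub>M I M)"
        using int uv by simp
      also have "\<bar>\<dots>\<bar> \<le> (\<integral>x. \<bar>g (u, x) - g (v, x)\<bar> \<partial>Pi\<^sub>M I M)"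
        by (rule integral_abs_bound)
      also have "\<dots> \<le> (\<integral>x. c i \<partial>Pi\<^sub>M I M)"
        using int uv * by (intro integral_mono) auto
      finally show "\<bar>(\<integral>x. g (u, x) \<partial>Pi\<^sub>M I M) - (\<integral>x. g (v, x) \<partial>Pi\<^sub>M I M)\<bar> \<le> c i"
        by (simp add: MI.prob_space)
    qed (use l in \<open>auto\<close>)
  qed (use gB in \<open>auto intro: Mi.prob_space_axioms MI.prob_space_axioms\<close>)
  also have "l\<^sup>2 * (\<Sum>i\<in>I. (c i)\<^sup>2) / 8 + l\<^sup>2 * (c i)\<^sup>2 / 8 = l\<^sup>2 * (\<Sum>i\<in>insert i I. (c i)\<^sup>2) / 8"
    using insert.hyps by (simp add: algebra_simps add_divide_distrib)
  finally have fin: "(\<integral>\<^sup>+z. ennreal (exp (l * (g z - integral\<^sup>L ?N g))) \<partial>?N)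
    \<le> ennreal (exp (l\<^sup>2 * (\<Sum>i\<in>insert i I. (c i)\<^sup>2) / 8))" .
  have E: "integral\<^sup>L (Pi\<^sub>M (insert i I) M) f = integral\<^sup>L ?N g"
    by (subst law[symmetric], subst integral_distr) (auto simp: g_def)
  have "(\<integral>\<^sup>+x. ennreal (exp (l * (f x - integral\<^sup>L ?N g))) \<partial>Pi\<^sub>M (insert i I) M)
      = (\<integral>\<^sup>+z. ennreal (exp (l * (g z - integral\<^sup>L ?N g))) \<partial>?N)"
    by (subst law[symmetric], subst nn_integral_distr) (auto simp: g_def)
  with fin show ?case by (simp add: E)
qed

text \<open>The mean over the second block keeps the bounded differences in the first block, so
  \<open>mgf_pair\<close> applies once more; a Chernoff bound then turns the moment generating
  function into a tail.\<close>

lemma mcdiarmid_pair: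
  fixes f :: "('i \<Rightarrow> 'a) \<times> ('j \<Rightarrow> 'b) \<Rightarrow> real"
  assumes I: "finite I" "\<And>i. i \<in> I \<Longrightarrow> prob_space (M i)"
    and J: "finite J" "\<And>j. j \<in> J \<Longrightarrow> prob_space (N j)"
    and f[measurable]: "f \<in> borel_measurable (Pi\<^sub>M I M \<Otimes>\<^sub>M Pi\<^sub>M J N)"
    and bd: "\<And>x y. x \<in> space (Pi\<^sub>M I M) \<Longrightarrow> y \<in> space (Pi\<^sub>M J N) \<Longrightarrow> \<bar>f (x, y)\<bar> \<le> B"
    and c: "\<And>x y i u. x \<in> space (Pi\<^sub>M I M) \<Longrightarrow> y \<in> space (Pi\<^sub>M J N) \<Longrightarrow> i \<in> I \<Longrightarrow> u \<in> space (M i)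
      \<Longrightarrow> \<bar>f (x(i := u), y) - f (x, y)\<bar> \<le> c i"
    and d: "\<And>x y j v. x \<in> space (Pi\<^sub>M I M) \<Longrightarrow> y \<in> space (Pi\<^sub>M J N) \<Longrightarrow> j \<in> J \<Longrightarrow> v \<in> space (N j)
      \<Longrightarrow> \<bar>f (x, y(j := v)) - f (x, y)\<bar> \<le> d j"
    and C: "C = (\<Sum>i\<in>I. (c i)\<^sup>2) + (\<Sum>j\<in>J. (d j)\<^sup>2)" "0 < C"
    and t: "0 < t"
  shows "measure (Pi\<^sub>M I M \<Otimes>\<^sub>M Pi\<^sub>M J N)
      {z \<in> space (Pi\<^sub>M I M \<Otimes>\<^sub>M Pi\<^sub>M J N). t \<le> f z - integral\<^sup>L (Pi\<^sub>M I M \<Otimes>\<^sub>M Pi\<^sub>M J N) f}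
    \<le> exp (- 2 * t\<^sup>2 / C)"
proof -
  let ?A = "Pi\<^sub>M I M" and ?B = "Pi\<^sub>M J N"
  interpret A: prob_space ?A using I by (intro prob_space_PiM)
  interpret B: prob_space ?B using J by (intro prob_space_PiM)
  interpret AB: pair_prob_space ?A ?B ..
  \<comment> \<open>The minimiser of the Chernoff exponent \<open>- l * t + l^2 * C / 8\<close>; the
    minimum is \<open>- 2 * t^2 / C\<close>.\<close>
  define l where "l = 4 * t / C"
  have l: "0 < l" using t C by (simp add: l_def)
  have upd: "x(i := u) \<in> space ?A" if "x \<in> space ?A" "i \<in> I" "u \<in> space (M i)" for x i u
    using that by (auto simp: space_PiM PiE_iff extensional_def)
  have int: "integrable ?B (\<lambda>y. f (x, y))" if "x \<in> space ?A" for x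
    using that bd by (intro B.integrable_const_bound[where B = B]) auto
  have "(\<integral>\<^sup>+z. ennreal (exp (l * (f z - integral\<^sup>L (?A \<Otimes>\<^sub>M ?B) f))) \<partial>(?A \<Otimes>\<^sub>M ?B))
      \<le> ennreal (exp (l\<^sup>2 * (\<Sum>j\<in>J. (d j)\<^sup>2) / 8 + l\<^sup>2 * (\<Sum>i\<in>I. (c i)\<^sup>2) / 8))"
  proof (rule mgf_pair[where B = B])
    fix x assume x: "x \<in> space ?A"
    show "(\<integral>\<^sup>+y. ennreal (exp (l * (f (x, y) - (\<integral>y. f (x, y) \<partial>?B)))) \<partial>?B)
      \<le> ennreal (exp (l\<^sup>2 * (\<Sum>j\<in>J. (d j)\<^sup>2) / 8))"
      by (rule mgf_bounded_differences[where B = B]) (use J bd d l x in auto)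
  next
    show "(\<integral>\<^sup>+x. ennreal (exp (l * ((\<integral>y. f (x, y) \<partial>?B) - (\<integral>x. (\<integral>y. f (x, y) \<partial>?B) \<partial>?A)))) \<partial>?A)
      \<le> ennreal (exp (l\<^sup>2 * (\<Sum>i\<in>I. (c i)\<^sup>2) / 8))"
    proof (rule mgf_bounded_differences[where B = B])
      fix x assume x: "x \<in> space ?A"
      have "\<bar>\<integral>y. f (x, y) \<partial>?B\<bar> \<le> (\<integral>y. \<bar>f (x, y)\<bar> \<partial>?B)" by (rule integral_abs_bound)
      also have "\<dots> \<le> (\<integral>y. B \<partial>?B)" using int[OF x] bd x by (intro integral_mono) auto
      finally show "\<bar>\<integral>y. f (x, y) \<partial>?B\<bar> \<le> B" by (simp add: B.prob_space)
    next
      fix x i u assume x: "x \<in> space ?A" "i \<in> I" "u \<in> space (M i)"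
      have "(\<integral>y. f (x(i := u), y) \<partial>?B) - (\<integral>y. f (x, y) \<partial>?B) = (\<integral>y. f (x(i := u), y) - f (x, y) \<partial>?B)"
        using int[OF x(1)] int[OF upd[OF x]] by simp
      also have "\<bar>\<dots>\<bar> \<le> (\<integral>y. \<bar>f (x(i := u), y) - f (x, y)\<bar> \<partial>?B)" by (rule integral_abs_bound)
      also have "\<dots> \<le> (\<integral>y. c i \<partial>?B)"
        using int[OF x(1)] int[OF upd[OF x]] c x by (intro integral_mono) auto
      finally show "\<bar>(\<integral>y. f (x(i := u), y) \<partial>?B) - (\<integral>y. f (x, y) \<partial>?B)\<bar> \<le> c i" by (simp add: B.prob_space)
    qed (use I l in auto)
  qed (use bd in \<open>auto simp: space_pair_measure intro: A.prob_space_axioms B.prob_space_axioms\<close>)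
  also have "l\<^sup>2 * (\<Sum>j\<in>J. (d j)\<^sup>2) / 8 + l\<^sup>2 * (\<Sum>i\<in>I. (c i)\<^sup>2) / 8 = l\<^sup>2 * C / 8"
    by (simp add: C algebra_simps add_divide_distrib)
  finally have mgf: "(\<integral>\<^sup>+z. ennreal (exp (l * (f z - integral\<^sup>L (?A \<Otimes>\<^sub>M ?B) f))) \<partial>(?A \<Otimes>\<^sub>M ?B))
      \<le> ennreal (exp (l\<^sup>2 * C / 8))" .
  have "emeasure (?A \<Otimes>\<^sub>M ?B) {z \<in> space (?A \<Otimes>\<^sub>M ?B). t \<le> f z - integral\<^sup>L (?A \<Otimes>\<^sub>M ?B) f}
      \<le> ennreal (exp (- l * t)) * (\<integral>\<^sup>+z. ennreal (exp (l * (f z - integral\<^sup>L (?A \<Otimes>\<^sub>M ?B) f)))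
          * indicator (space (?A \<Otimes>\<^sub>M ?B)) z \<partial>(?A \<Otimes>\<^sub>M ?B))"
    using l by (intro Chernoff_ineq_nn_integral_ge) auto
  also have "\<dots> = ennreal (exp (- l * t)) * (\<integral>\<^sup>+z. ennreal (exp (l * (f z - integral\<^sup>L (?A \<Otimes>\<^sub>M ?B) f))) \<partial>(?A \<Otimes>\<^sub>M ?B))"
    by (intro arg_cong2[where f = "(*)"] refl nn_integral_cong) auto
  also have "\<dots> \<le> ennreal (exp (- l * t)) * ennreal (exp (l\<^sup>2 * C / 8))"
    using mgf by (intro mult_left_mono) auto
  also have "\<dots> = ennreal (exp (- l * t + l\<^sup>2 * C / 8))"
    by (simp only: exp_add ennreal_mult exp_ge_zero)
  also have "- l * t + l\<^sup>2 * C / 8 = - 2 * t\<^sup>2 / C"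
    using C(2) by (simp add: l_def power2_eq_square field_simps)
  finally show ?thesis
    by (simp add: AB.emeasure_eq_measure)
qed

section \<open>Concentration for two independent samples\<close>

lemma two_sample_law:
  fixes P :: "'a measure" and Q :: "'a measure"
  assumes "prob_space M" and NP: "1 \<le> NP" and NQ: "1 \<le> NQ"
    and X: "iid_sample M NP X P" and Y: "iid_sample M NQ Y Q"
    and XY: "indep_samples M NP X P NQ Y Q"
  shows "(\<lambda>\<omega>. (\<lambda>i\<in>{1..NP}. X i \<omega>, \<lambda>j\<in>{1..NQ}. Y j \<omega>))
      \<in> measurable M ((\<Pi>\<^sub>M i\<in>{1..NP}. P) \<Otimes>\<^sub>M (\<Pi>\<^sub>M j\<in>{1..NQ}. Q))"
    and "distr M ((\<Pi>\<^sub>M i\<in>{1..NP}. P) \<Otimes>\<^sub>M (\<Pi>\<^sub>M j\<in>{1..NQ}. Q))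
        (\<lambda>\<omega>. (\<lambda>i\<in>{1..NP}. X i \<omega>, \<lambda>j\<in>{1..NQ}. Y j \<omega>))
      = (\<Pi>\<^sub>M i\<in>{1..NP}. P) \<Otimes>\<^sub>M (\<Pi>\<^sub>M j\<in>{1..NQ}. Q)"
proof -
  interpret prob_space M by fact
  have law: "distr M (\<Pi>\<^sub>M i\<in>{1..N}. R) (\<lambda>\<omega>. \<lambda>i\<in>{1..N}. Z i \<omega>) = (\<Pi>\<^sub>M i\<in>{1..N}. R)"
    if "1 \<le> N" "iid_sample M N Z R" for N Z and R :: "'a measure"
  proof -
    have ind: "indep_vars (\<lambda>_. R) Z {1..N}" and d: "\<And>i. i \<in> {1..N} \<Longrightarrow> distr M R (Z i) = R"
      using that(2) by (auto simp: iid_sample_def)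
    have rv: "random_variable R (Z i)" if "i \<in> {1..N}" for i
      using ind that unfolding indep_vars_def by blast
    have "distr M (\<Pi>\<^sub>M i\<in>{1..N}. R) (\<lambda>\<omega>. \<lambda>i\<in>{1..N}. Z i \<omega>) = (\<Pi>\<^sub>M i\<in>{1..N}. distr M R (Z i))"
      using ind that(1) rv by (subst (asm) indep_vars_iff_distr_eq_PiM') auto
    also have "\<dots> = (\<Pi>\<^sub>M i\<in>{1..N}. R)" using d by (intro PiM_cong) auto
    finally show ?thesis .
  qed
  have *: "indep_var (\<Pi>\<^sub>M i\<in>{1..NP}. P) (\<lambda>\<omega>. \<lambda>i\<in>{1..NP}. X i \<omega>) (\<Pi>\<^sub>M j\<in>{1..NQ}. Q) (\<lambda>\<omega>. \<lambda>j\<in>{1..NQ}. Y j \<omega>)"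
    using XY by (simp add: indep_samples_def)
  show "(\<lambda>\<omega>. (\<lambda>i\<in>{1..NP}. X i \<omega>, \<lambda>j\<in>{1..NQ}. Y j \<omega>))
      \<in> measurable M ((\<Pi>\<^sub>M i\<in>{1..NP}. P) \<Otimes>\<^sub>M (\<Pi>\<^sub>M j\<in>{1..NQ}. Q))"
    using indep_var_rv1[OF *] indep_var_rv2[OF *] by (rule measurable_Pair)
  show "distr M ((\<Pi>\<^sub>M i\<in>{1..NP}. P) \<Otimes>\<^sub>M (\<Pi>\<^sub>M j\<in>{1..NQ}. Q))
        (\<lambda>\<omega>. (\<lambda>i\<in>{1..NP}. X i \<omega>, \<lambda>j\<in>{1..NQ}. Y j \<omega>))
      = (\<Pi>\<^sub>M i\<in>{1..NP}. P) \<Otimes>\<^sub>M (\<Pi>\<^sub>M j\<in>{1..NQ}. Q)"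
    using * law[OF NP X] law[OF NQ Y] by (simp add: indep_var_distribution_eq)
qed

lemma iid_sample_measurable:
  assumes "prob_space M" "iid_sample M N X P" "i \<in> {1..N}"
  shows "X i \<in> measurable M P"
  using assms unfolding iid_sample_def prob_space.indep_vars_def[OF assms(1)] by blast

lemma iid_sample_AE:
  assumes M: "prob_space M" and X: "iid_sample M N X P" and "AE x in P. R x"
  shows "AE \<omega> in M. \<forall>i\<in>{1..N}. R (X i \<omega>)"
proof (rule AE_finite_allI)
  fix i assume i: "i \<in> {1..N}"
  have "distr M P (X i) = P" using X i by (auto simp: iid_sample_def)
  hence "AE x in distr M P (X i). R x" using assms(3) by metis
  thus "AE \<omega> in M. R (X i \<omega>)"
    using AE_distrD[OF iid_sample_measurable[OF M X i]] by simp
qed simp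

text \<open>Outside the supports the function need not have bounded differences, so it is first composed
  with the retractions of the two spaces onto the supports; almost surely this changes nothing.\<close>

lemma mcdiarmid_two_samples:
  fixes P Q :: "'a measure" and f :: "(nat \<Rightarrow> 'a) \<times> (nat \<Rightarrow> 'a) \<Rightarrow> real"
  assumes M: "prob_space M" and P: "prob_space P" and Q: "prob_space Q"
    and NP: "1 \<le> NP" and NQ: "1 \<le> NQ"
    and X: "iid_sample M NP X P" and Y: "iid_sample M NQ Y Q"
    and XY: "indep_samples M NP X P NQ Y Q"
    and DP: "measure P DP = 1" and DQ: "measure Q DQ = 1"
    and f[measurable]: "f \<in> borel_measurable ((\<Pi>\<^sub>M i\<in>{1..NP}. P) \<Otimes>\<^sub>M (\<Pi>\<^sub>M j\<in>{1..NQ}. Q))"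
    and bd: "\<And>x y. x \<in> {1..NP} \<rightarrow>\<^sub>E DP \<Longrightarrow> y \<in> {1..NQ} \<rightarrow>\<^sub>E DQ \<Longrightarrow> \<bar>f (x, y)\<bar> \<le> B"
    and c: "\<And>x y i u. x \<in> {1..NP} \<rightarrow>\<^sub>E DP \<Longrightarrow> y \<in> {1..NQ} \<rightarrow>\<^sub>E DQ \<Longrightarrow> i \<in> {1..NP} \<Longrightarrow> u \<in> DP
      \<Longrightarrow> \<bar>f (x(i := u), y) - f (x, y)\<bar> \<le> c"
    and d: "\<And>x y j v. x \<in> {1..NP} \<rightarrow>\<^sub>E DP \<Longrightarrow> y \<in> {1..NQ} \<rightarrow>\<^sub>E DQ \<Longrightarrow> j \<in> {1..NQ} \<Longrightarrow> v \<in> DQ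
      \<Longrightarrow> \<bar>f (x, y(j := v)) - f (x, y)\<bar> \<le> d"
    and C: "C = real NP * c\<^sup>2 + real NQ * d\<^sup>2" "0 < C"
    and t: "0 < t"
    and Z: "Z = (\<lambda>\<omega>. (\<lambda>i\<in>{1..NP}. X i \<omega>, \<lambda>j\<in>{1..NQ}. Y j \<omega>))"
  shows "measure M {\<omega> \<in> space M. t \<le> f (Z \<omega>) - (\<integral>\<omega>. f (Z \<omega>) \<partial>M)} \<le> exp (- 2 * t\<^sup>2 / C)"
proof -
  interpret M: prob_space M by fact
  interpret P: prob_space P by fact
  interpret Q: prob_space Q by fact
  let ?R = "(\<Pi>\<^sub>M i\<in>{1..NP}. P) \<Otimes>\<^sub>M (\<Pi>\<^sub>M j\<in>{1..NQ}. Q)"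
  have mZ[measurable]: "Z \<in> measurable M ?R" and law: "distr M ?R Z = ?R"
    unfolding Z using two_sample_law[OF M NP NQ X Y XY] by blast+
  \<comment> \<open>A non-measurable set has \<open>measure\<close> 0 by convention, so measure 1
    forces measurability.\<close>
  have DP_sets[measurable]: "DP \<in> sets P" and DQ_sets[measurable]: "DQ \<in> sets Q"
    using DP DQ by (metis measure_notin_sets zero_neq_one)+
  have "DP \<noteq> {}" "DQ \<noteq> {}" using DP DQ by auto
  then obtain x0 y0 where x0: "x0 \<in> DP" and y0: "y0 \<in> DQ" by auto
  have sub: "x0 \<in> space P" "y0 \<in> space Q"
    using x0 y0 sets.sets_into_space[OF DP_sets] sets.sets_into_space[OF DQ_sets] by auto
  define r where "r = (\<lambda>x. if x \<in> DP then x else x0)"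
  define q where "q = (\<lambda>y. if y \<in> DQ then y else y0)"
  have r: "r x \<in> DP" "x \<in> DP \<Longrightarrow> r x = x" and q: "q y \<in> DQ" "y \<in> DQ \<Longrightarrow> q y = y" for x y
    using x0 y0 by (auto simp: r_def q_def)
  have [measurable]: "r \<in> measurable P P" "q \<in> measurable Q Q"
    using sub unfolding r_def q_def by auto
  define ret where "ret = (\<lambda>(x, y). (\<lambda>i\<in>{1..NP}. r (x i), \<lambda>j\<in>{1..NQ}. q (y j)))"
  have mret: "ret \<in> measurable ?R ?R"
    unfolding ret_def by measurable
  define g where "g = (\<lambda>z. f (ret z))"
  have g[measurable]: "g \<in> borel_measurable ?R"
    unfolding g_def using mret by measurable
  have "AE x in P. x \<in> DP" "AE y in Q. y \<in> DQ"
    using DP DQ by (auto simp: P.AE_in_set_eq_1 Q.AE_in_set_eq_1)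
  hence "AE \<omega> in M. \<forall>i\<in>{1..NP}. X i \<omega> \<in> DP" "AE \<omega> in M. \<forall>j\<in>{1..NQ}. Y j \<omega> \<in> DQ"
    using iid_sample_AE[OF M X, of "\<lambda>x. x \<in> DP"] iid_sample_AE[OF M Y, of "\<lambda>y. y \<in> DQ"] by auto
  hence gf: "AE \<omega> in M. g (Z \<omega>) = f (Z \<omega>)"
    by eventually_elim (auto simp: g_def ret_def Z r q intro!: arg_cong[where f = f])
  have retfst: "(\<lambda>i\<in>{1..NP}. r (x i)) \<in> {1..NP} \<rightarrow>\<^sub>E DP" and retsnd: "(\<lambda>j\<in>{1..NQ}. q (y j)) \<in> {1..NQ} \<rightarrow>\<^sub>E DQ"
    for x y using r q by auto
  have "measure ?R {z \<in> space ?R. t \<le> g z - integral\<^sup>L ?R g} \<le> exp (- 2 * t\<^sup>2 / C)"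
  proof (rule mcdiarmid_pair[where B = B and c = "\<lambda>_. c" and d = "\<lambda>_. d"])
    fix x y and i and u
    assume i: "i \<in> {1..NP}"
    \<comment> \<open>The retraction acts coordinatewise, so an update by an arbitrary
      \<open>u\<close> becomes an update by \<open>r u\<close>, which lies in \<open>DP\<close> as
      the bounded-difference hypothesis requires.\<close>
    have "(\<lambda>k\<in>{1..NP}. r ((x(i := u)) k)) = (\<lambda>k\<in>{1..NP}. r (x k))(i := r u)"
      using i by (auto simp: fun_eq_iff)
    thus "\<bar>g (x(i := u), y) - g (x, y)\<bar> \<le> c"
      using c[OF retfst[of x] retsnd[of y] i r(1)[of u]] by (simp add: g_def ret_def)
  next
    fix x y and j and v
    assume j: "j \<in> {1..NQ}"
    have "(\<lambda>k\<in>{1..NQ}. q ((y(j := v)) k)) = (\<lambda>k\<in>{1..NQ}. q (y k))(j := q v)"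
      using j by (auto simp: fun_eq_iff)
    thus "\<bar>g (x, y(j := v)) - g (x, y)\<bar> \<le> d"
      using d[OF retfst[of x] retsnd[of y] j q(1)[of v]] by (simp add: g_def ret_def)
  next
    fix x y
    show "\<bar>g (x, y)\<bar> \<le> B" using bd[OF retfst[of x] retsnd[of y]] by (simp add: g_def ret_def)
  qed (use g C t in \<open>auto intro: P.prob_space_axioms Q.prob_space_axioms\<close>)
  also have "integral\<^sup>L ?R g = (\<integral>\<omega>. g (Z \<omega>) \<partial>M)"
    by (subst law[symmetric], rule integral_distr[OF mZ g])
  also have "\<dots> = (\<integral>\<omega>. f (Z \<omega>) \<partial>M)"
    using gf by (intro integral_cong_AE) auto
  finally have "measure (distr M ?R Z) {z \<in> space ?R. t \<le> g z - (\<integral>\<omega>. f (Z \<omega>) \<partial>M)} \<le> exp (- 2 * t\<^sup>2 / C)"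
    by (simp only: law)
  also have "measure (distr M ?R Z) {z \<in> space ?R. t \<le> g z - (\<integral>\<omega>. f (Z \<omega>) \<partial>M)}
      = measure M (Z -` {z \<in> space ?R. t \<le> g z - (\<integral>\<omega>. f (Z \<omega>) \<partial>M)} \<inter> space M)"
    by (rule measure_distr[OF mZ]) measurable
  also have "Z -` {z \<in> space ?R. t \<le> g z - (\<integral>\<omega>. f (Z \<omega>) \<partial>M)} \<inter> space M
      = {\<omega> \<in> space M. t \<le> g (Z \<omega>) - (\<integral>\<omega>. f (Z \<omega>) \<partial>M)}"
    using measurable_space[OF mZ] by auto
  also have "measure M \<dots> = measure M {\<omega> \<in> space M. t \<le> f (Z \<omega>) - (\<integral>\<omega>. f (Z \<omega>) \<partial>M)}"
    using gf by (intro M.finite_measure_eq_AE) auto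
  finally show ?thesis .
qed

section \<open>Transport between empirical measures\<close>

text \<open>Transport plans between uniform weights on \<open>m\<close> and \<open>n\<close> indices; entries outside
  \<open>{1..m} \<times> {1..n}\<close> carry no meaning.\<close>

definition plans :: "nat \<Rightarrow> nat \<Rightarrow> (nat \<times> nat \<Rightarrow> real) set" where
  "plans m n = {w. (\<forall>p. 0 \<le> w p)
     \<and> (\<forall>i\<in>{1..m}. (\<Sum>j=1..n. w (i, j)) = 1 / real m)
     \<and> (\<forall>j\<in>{1..n}. (\<Sum>i=1..m. w (i, j)) = 1 / real n)}"

definition plan_cost :: "nat \<Rightarrow> nat \<Rightarrow> (nat \<Rightarrow> nat \<Rightarrow> real) \<Rightarrow> (nat \<times> nat \<Rightarrow> real) \<Rightarrow> real" where
  "plan_cost m n c w = (\<Sum>i=1..m. \<Sum>j=1..n. w (i, j) * c i j)"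

text \<open>Supplies the nonemptiness that every infimum over \<open>plans\<close> requires.\<close>

lemma uniform_plan: "1 \<le> m \<Longrightarrow> 1 \<le> n \<Longrightarrow> (\<lambda>_. 1 / (real m * real n)) \<in> plans m n"
  by (auto simp: plans_def)

lemma plan_cost_cong:
  "(\<And>i j. i \<in> {1..m} \<Longrightarrow> j \<in> {1..n} \<Longrightarrow> c i j = c' i j) \<Longrightarrow> plan_cost m n c w = plan_cost m n c' w"
  by (simp add: plan_cost_def)

lemma plan_cost_const: "1 \<le> m \<Longrightarrow> w \<in> plans m n \<Longrightarrow> plan_cost m n (\<lambda>_ _. k) w = k"
  by (simp add: plan_cost_def plans_def flip: sum_distrib_right)

lemma plan_cost_mono:
  assumes "w \<in> plans m n" "\<And>i j. i \<in> {1..m} \<Longrightarrow> j \<in> {1..n} \<Longrightarrow> c i j \<le> c' i j"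
  shows "plan_cost m n c w \<le> plan_cost m n c' w"
  unfolding plan_cost_def using assms by (intro sum_mono mult_left_mono) (auto simp: plans_def)

lemma plan_cost_add: "plan_cost m n (\<lambda>i j. c i j + c' i j) w = plan_cost m n c w + plan_cost m n c' w"
  by (simp add: plan_cost_def algebra_simps sum.distrib)

text \<open>A row of a plan has total mass 1/m however that mass is distributed. This is where a
  single sample gets its influence of order 1/N.\<close>

lemma plan_cost_row:
  assumes "w \<in> plans m n" "k \<in> {1..m}"
  shows "plan_cost m n (\<lambda>i j. if i = k then a else 0) w = a / real m"
proof -
  have "plan_cost m n (\<lambda>i j. if i = k then a else 0) w = (\<Sum>i=1..m. if i = k then (\<Sum>j=1..n. w (i, j)) * a else 0)"
    unfolding plan_cost_def by (intro sum.cong) (auto simp: sum_distrib_right)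
  thus ?thesis using assms by (simp add: plans_def)
qed

lemma plan_cost_col:
  assumes "w \<in> plans m n" "k \<in> {1..n}"
  shows "plan_cost m n (\<lambda>i j. if j = k then a else 0) w = a / real n"
proof -
  have "plan_cost m n (\<lambda>i j. if j = k then a else 0) w = (\<Sum>j=1..n. \<Sum>i=1..m. w (i, j) * (if j = k then a else 0))"
    unfolding plan_cost_def by (rule sum.swap)
  also have "\<dots> = (\<Sum>j=1..n. if j = k then (\<Sum>i=1..m. w (i, j)) * a else 0)"
    by (intro sum.cong) (auto simp: sum_distrib_right)
  finally show ?thesis using assms by (simp add: plans_def)
qed

section \<open>The value of the finite transport problem: stability and measurability\<close>

definition min_cost :: "nat \<Rightarrow> nat \<Rightarrow> (nat \<Rightarrow> nat \<Rightarrow> real) \<Rightarrow> real" where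
  "min_cost m n c = (INF w\<in>plans m n. plan_cost m n c w)"

lemma min_cost_cong:
  "(\<And>i j. i \<in> {1..m} \<Longrightarrow> j \<in> {1..n} \<Longrightarrow> c i j = c' i j) \<Longrightarrow> min_cost m n c = min_cost m n c'"
  unfolding min_cost_def by (intro INF_cong refl plan_cost_cong)

lemma plan_cost_bounds:
  assumes "1 \<le> m" "w \<in> plans m n" "\<And>i j. i \<in> {1..m} \<Longrightarrow> j \<in> {1..n} \<Longrightarrow> a \<le> c i j \<and> c i j \<le> b"
  shows "a \<le> plan_cost m n c w" "plan_cost m n c w \<le> b"
  using plan_cost_mono[OF assms(2), of "\<lambda>_ _. a" c] plan_cost_mono[OF assms(2), of c "\<lambda>_ _. b"]
    plan_cost_const[OF assms(1,2)] assms(3) by auto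

text \<open>A real infimum is only meaningful for a set bounded below. A plan has total mass 1, so
  any bound on the entries bounds the cost; the sum of all absolute entries is a crude one.\<close>

lemma bdd_below_plan_cost: "1 \<le> m \<Longrightarrow> bdd_below (plan_cost m n c ` plans m n)"
proof (rule bdd_belowI2)
  fix w assume m: "1 \<le> m" and w: "w \<in> plans m n"
  define a where "a = (\<Sum>i=1..m. \<Sum>j=1..n. \<bar>c i j\<bar>)"
  have "- a \<le> c i j \<and> c i j \<le> a" if "i \<in> {1..m}" "j \<in> {1..n}" for i j
  proof -
    have "\<bar>c i j\<bar> \<le> (\<Sum>j=1..n. \<bar>c i j\<bar>)" using that by (intro member_le_sum) auto
    also have "\<dots> \<le> a" unfolding a_def using that by (intro member_le_sum[of i]) (auto intro: sum_nonneg)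
    finally show ?thesis by auto
  qed
  from plan_cost_bounds(1)[OF m w this] show "- (\<Sum>i=1..m. \<Sum>j=1..n. \<bar>c i j\<bar>) \<le> plan_cost m n c w"
    unfolding a_def .
qed

lemma min_cost_bounds:
  assumes "1 \<le> m" "1 \<le> n" "\<And>i j. i \<in> {1..m} \<Longrightarrow> j \<in> {1..n} \<Longrightarrow> a \<le> c i j \<and> c i j \<le> b"
  shows "a \<le> min_cost m n c" "min_cost m n c \<le> b"
proof -
  show "a \<le> min_cost m n c"
    unfolding min_cost_def using plan_cost_bounds(1)[OF assms(1) _ assms(3)] uniform_plan[OF assms(1,2)]
    by (intro cINF_greatest) auto
  show "min_cost m n c \<le> b"
    unfolding min_cost_def using plan_cost_bounds(2)[OF assms(1) _ assms(3)] uniform_plan[OF assms(1,2)]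
    by (intro cINF_lower2[OF bdd_below_plan_cost[OF assms(1)]]) auto
qed

lemma min_cost_le_add:
  assumes "1 \<le> m" "1 \<le> n" "\<And>w. w \<in> plans m n \<Longrightarrow> plan_cost m n c w \<le> plan_cost m n c' w + e"
  shows "min_cost m n c \<le> min_cost m n c' + e"
proof -
  have "min_cost m n c - e \<le> plan_cost m n c' w" if "w \<in> plans m n" for w
    using cINF_lower[OF bdd_below_plan_cost[OF assms(1)] that, of c] assms(3)[OF that]
    by (simp add: min_cost_def)
  hence "min_cost m n c - e \<le> min_cost m n c'"
    unfolding min_cost_def[of m n c'] using uniform_plan[OF assms(1,2)]
    by (intro cINF_greatest) auto
  thus ?thesis by simp
qed

text \<open>The feasible set does not depend on the cost matrix. Hence a bound on the change of cost
  that holds for every plan passes to the infimum, and by \<open>plan_cost_row\<close> a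
  perturbation confined to one row changes each plan's cost by at most
  \<open>a / real m\<close>.\<close>

lemma min_cost_row_change:
  assumes m: "1 \<le> m" and n: "1 \<le> n" and k: "k \<in> {1..m}"
    and eq: "\<And>i j. i \<in> {1..m} \<Longrightarrow> j \<in> {1..n} \<Longrightarrow> i \<noteq> k \<Longrightarrow> c i j = c' i j"
    and le: "\<And>j. j \<in> {1..n} \<Longrightarrow> \<bar>c k j - c' k j\<bar> \<le> a"
  shows "\<bar>min_cost m n c - min_cost m n c'\<bar> \<le> a / real m"
proof -
  have *: "plan_cost m n b w \<le> plan_cost m n b' w + a / real m"
    if w: "w \<in> plans m n" and b: "\<And>i j. i \<in> {1..m} \<Longrightarrow> j \<in> {1..n} \<Longrightarrow> b i j \<le> b' i j + (if i = k then a else 0)"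
    for b b' w
    using plan_cost_mono[OF w, of b "\<lambda>i j. b' i j + (if i = k then a else 0)"] b plan_cost_row[OF w k, of a] by (simp add: plan_cost_add)
  have "c i j \<le> c' i j + (if i = k then a else 0)" "c' i j \<le> c i j + (if i = k then a else 0)"
    if "i \<in> {1..m}" "j \<in> {1..n}" for i j
    using eq[OF that] le[OF that(2)] by (auto simp: abs_le_iff)
  hence "min_cost m n c \<le> min_cost m n c' + a / real m" "min_cost m n c' \<le> min_cost m n c + a / real m"
    using min_cost_le_add[OF m n *] by auto
  thus ?thesis by (simp add: abs_le_iff)
qed

lemma min_cost_col_change:
  assumes m: "1 \<le> m" and n: "1 \<le> n" and k: "k \<in> {1..n}"
    and eq: "\<And>i j. i \<in> {1..m} \<Longrightarrow> j \<in> {1..n} \<Longrightarrow> j \<noteq> k \<Longrightarrow> c i j = c' i j"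
    and le: "\<And>i. i \<in> {1..m} \<Longrightarrow> \<bar>c i k - c' i k\<bar> \<le> a"
  shows "\<bar>min_cost m n c - min_cost m n c'\<bar> \<le> a / real n"
proof -
  have *: "plan_cost m n b w \<le> plan_cost m n b' w + a / real n"
    if w: "w \<in> plans m n" and b: "\<And>i j. i \<in> {1..m} \<Longrightarrow> j \<in> {1..n} \<Longrightarrow> b i j \<le> b' i j + (if j = k then a else 0)"
    for b b' w
    using plan_cost_mono[OF w, of b "\<lambda>i j. b' i j + (if j = k then a else 0)"] b plan_cost_col[OF w k, of a] by (simp add: plan_cost_add)
  have "c i j \<le> c' i j + (if j = k then a else 0)" "c' i j \<le> c i j + (if j = k then a else 0)"
    if "i \<in> {1..m}" "j \<in> {1..n}" for i j
    using eq[OF that] le[OF that(1)] by (auto simp: abs_le_iff)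
  hence "min_cost m n c \<le> min_cost m n c' + a / real n" "min_cost m n c' \<le> min_cost m n c + a / real n"
    using min_cost_le_add[OF m n *] by auto
  thus ?thesis by (simp add: abs_le_iff)
qed

text \<open>One sequence serves all cost matrices, since the feasible set is independent of
  \<open>c\<close> and every cost is continuous in the plan. Functions on the countable set of index
  pairs form a second countable space, so every set of them is separable.\<close>

lemma dense_plans:
  assumes "1 \<le> m" "1 \<le> n"
  obtains t :: "nat \<Rightarrow> nat \<times> nat \<Rightarrow> real"
  where "\<And>k. t k \<in> plans m n"
    and "\<And>c e. 0 < e \<Longrightarrow> \<exists>k. plan_cost m n c (t k) < min_cost m n c + e"
proof -
  obtain T where T: "countable T" "T \<subseteq> plans m n" "plans m n \<subseteq> closure T"
    by (rule separable)
  have ne: "T \<noteq> {}" using T(3) uniform_plan[OF assms] by auto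
  show thesis
  proof (rule that[of "from_nat_into T"])
    show "from_nat_into T k \<in> plans m n" for k
      using from_nat_into[OF ne] T(2) by auto
    fix c and e :: real assume e: "0 < e"
    have "\<exists>w\<in>plans m n. plan_cost m n c w < min_cost m n c + e"
      unfolding min_cost_def using e uniform_plan[OF assms]
      by (subst cINF_less_iff[symmetric]) (auto intro: bdd_below_plan_cost assms)
    then obtain w where w: "w \<in> plans m n" "plan_cost m n c w < min_cost m n c + e" by blast
    \<comment> \<open>Only finitely many entries of the plan enter the cost, and evaluation at an
      entry is continuous in the product topology.\<close>
    have "continuous_on UNIV (plan_cost m n c)"
      unfolding plan_cost_def
      by (intro continuous_on_sum continuous_on_mult continuous_on_const continuous_on_product_coordinates)
    hence "open {v. plan_cost m n c v < min_cost m n c + e}"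
      by (intro open_Collect_less continuous_on_const)
    moreover have "w \<in> closure T" using w T(3) by auto
    ultimately have "T \<inter> {v. plan_cost m n c v < min_cost m n c + e} \<noteq> {}"
      using w(2) open_Int_closure_eq_empty[of "{v. plan_cost m n c v < min_cost m n c + e}" T] by blast
    then obtain v where "v \<in> T" "plan_cost m n c v < min_cost m n c + e" by blast
    thus "\<exists>k. plan_cost m n c (from_nat_into T k) < min_cost m n c + e"
      using from_nat_into_surj[OF T(1)] by metis
  qed
qed

lemma borel_measurable_plan_cost:
  assumes "\<And>i j. i \<in> {1..m} \<Longrightarrow> j \<in> {1..n} \<Longrightarrow> (\<lambda>\<omega>. c \<omega> i j) \<in> borel_measurable M"
  shows "(\<lambda>\<omega>. plan_cost m n (c \<omega>) w) \<in> borel_measurable M"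
  unfolding plan_cost_def using assms by (intro borel_measurable_sum borel_measurable_times) auto

text \<open>An infimum over uncountably many plans is reduced to a countable one: its strict
  sublevel sets are unions, over the dense sequence, of the strict sublevel sets of single
  costs.\<close>

lemma borel_measurable_min_cost:
  assumes m: "1 \<le> m" and n: "1 \<le> n"
    and c: "\<And>i j. i \<in> {1..m} \<Longrightarrow> j \<in> {1..n} \<Longrightarrow> (\<lambda>\<omega>. c \<omega> i j) \<in> borel_measurable M"
  shows "(\<lambda>\<omega>. min_cost m n (c \<omega>)) \<in> borel_measurable M"
proof -
  obtain t :: "nat \<Rightarrow> nat \<times> nat \<Rightarrow> real" where t: "\<And>k. t k \<in> plans m n"
    "\<And>c (e :: real). 0 < e \<Longrightarrow> \<exists>k. plan_cost m n c (t k) < min_cost m n c + e"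
    by (rule dense_plans[OF m n]) blast
  have lower: "min_cost m n c \<le> plan_cost m n c (t k)" for c k
    unfolding min_cost_def by (rule cINF_lower[OF bdd_below_plan_cost[OF m] t(1)])
  have less: "min_cost m n c < a \<longleftrightarrow> (\<exists>k. plan_cost m n c (t k) < a)" for c a
  proof
    show "\<exists>k. plan_cost m n c (t k) < a" if "min_cost m n c < a"
      using t(2)[of "a - min_cost m n c" c] that by auto
    show "min_cost m n c < a" if "\<exists>k. plan_cost m n c (t k) < a"
      using that lower[of c] by (meson le_less_trans)
  qed
  have [measurable]: "(\<lambda>\<omega>. plan_cost m n (c \<omega>) (t k)) \<in> borel_measurable M" for k
    by (rule borel_measurable_plan_cost[OF c])
  show ?thesis
  proof (rule borel_measurableI_less)
    fix a
    show "{\<omega> \<in> space M. min_cost m n (c \<omega>) < a} \<in> sets M"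
      unfolding less by measurable
  qed
qed

text \<open>The mixture over \<open>\<omega>\<close> of the discrete couplings that put mass \<open>w \<omega> (i, j)\<close> on the
  pair \<open>(X i \<omega>, Y j \<omega>)\<close>.\<close>

definition mix_coupling :: "'w measure \<Rightarrow> nat \<Rightarrow> nat \<Rightarrow> ('w \<Rightarrow> nat \<times> nat \<Rightarrow> real)
    \<Rightarrow> (nat \<Rightarrow> 'w \<Rightarrow> 'a::topological_space) \<Rightarrow> (nat \<Rightarrow> 'w \<Rightarrow> 'b::topological_space) \<Rightarrow> ('a \<times> 'b) measure" where
  "mix_coupling M m n w X Y =
     distr (density (M \<Otimes>\<^sub>M count_space ({1..m} \<times> {1..n})) (\<lambda>(\<omega>, p). ennreal (w \<omega> p)))
       (borel \<Otimes>\<^sub>M borel) (\<lambda>(\<omega>, p). (X (fst p) \<omega>, Y (snd p) \<omega>))"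

lemma sets_mix_coupling: "sets (mix_coupling M m n w X Y) = sets (borel \<Otimes>\<^sub>M borel)"
  by (simp add: mix_coupling_def)

text \<open>Over a countable discrete factor joint measurability can be checked section by section.
  It is applied to the random weights and to the random pair of sample points, as functions of
  \<omega> and the index pair.\<close>

lemma measurable_pair_countable2:
  assumes "countable I" and g: "\<And>p. p \<in> I \<Longrightarrow> (\<lambda>\<omega>. g (\<omega>, p)) \<in> measurable M K"
  shows "g \<in> measurable (M \<Otimes>\<^sub>M count_space I) K"
proof -
  have "(\<lambda>z. g (fst z, snd z)) \<in> measurable (M \<Otimes>\<^sub>M count_space I) K"
    by (rule measurable_compose_countable'[where I = I and f = "\<lambda>p z. g (fst z, p)"])
       (auto intro: measurable_compose[OF measurable_fst g] assms(1))
  thus ?thesis by simp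
qed

lemma nn_integral_mix_coupling:
  assumes X: "\<And>i. i \<in> {1..m} \<Longrightarrow> X i \<in> borel_measurable M"
    and Y: "\<And>j. j \<in> {1..n} \<Longrightarrow> Y j \<in> borel_measurable M"
    and w: "\<And>p. p \<in> {1..m} \<times> {1..n} \<Longrightarrow> (\<lambda>\<omega>. w \<omega> p) \<in> borel_measurable M"
    and f[measurable]: "f \<in> borel_measurable (borel \<Otimes>\<^sub>M borel)"
  shows "(\<integral>\<^sup>+z. f z \<partial>mix_coupling M m n w X Y)
    = (\<integral>\<^sup>+\<omega>. (\<Sum>i=1..m. \<Sum>j=1..n. ennreal (w \<omega> (i, j)) * f (X i \<omega>, Y j \<omega>)) \<partial>M)"
proof -
  let ?I = "{1..m} \<times> {1..n}"
  let ?h = "\<lambda>(\<omega>, p). (X (fst p) \<omega>, Y (snd p) \<omega>)"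
  interpret I: sigma_finite_measure "count_space ?I"
    by (rule sigma_finite_measure_count_space_finite) simp
  have h: "?h \<in> measurable (M \<Otimes>\<^sub>M count_space ?I) (borel \<Otimes>\<^sub>M borel)"
  proof (rule measurable_pair_countable2)
    fix p assume "p \<in> ?I"
    hence [measurable]: "X (fst p) \<in> borel_measurable M" "Y (snd p) \<in> borel_measurable M"
      using X Y by auto
    show "(\<lambda>\<omega>. ?h (\<omega>, p)) \<in> measurable M (borel \<Otimes>\<^sub>M borel)" by simp
  qed simp
  have wm: "(\<lambda>(\<omega>, p). ennreal (w \<omega> p)) \<in> borel_measurable (M \<Otimes>\<^sub>M count_space ?I)"
  proof (rule measurable_pair_countable2)
    fix p assume "p \<in> ?I"
    from w[OF this] show "(\<lambda>\<omega>. case (\<omega>, p) of (\<omega>, p) \<Rightarrow> ennreal (w \<omega> p)) \<in> borel_measurable M" by simp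
  qed simp
  have fh: "(\<lambda>z. f (?h z)) \<in> borel_measurable (M \<Otimes>\<^sub>M count_space ?I)"
    by (rule measurable_compose[OF h f])
  have "(\<integral>\<^sup>+z. f z \<partial>mix_coupling M m n w X Y)
      = (\<integral>\<^sup>+z. f (?h z) \<partial>density (M \<Otimes>\<^sub>M count_space ?I) (\<lambda>(\<omega>, p). ennreal (w \<omega> p)))"
    unfolding mix_coupling_def by (rule nn_integral_distr) (use h f in auto)
  also have "\<dots> = (\<integral>\<^sup>+z. (\<lambda>(\<omega>, p). ennreal (w \<omega> p)) z * f (?h z) \<partial>(M \<Otimes>\<^sub>M count_space ?I))"
    by (rule nn_integral_density[OF wm fh])
  also have "\<dots> = (\<integral>\<^sup>+\<omega>. \<integral>\<^sup>+p. (\<lambda>(\<omega>, p). ennreal (w \<omega> p)) (\<omega>, p) * f (?h (\<omega>, p)) \<partial>count_space ?I \<partial>M)"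
    by (rule I.nn_integral_fst[symmetric]) (use wm fh in measurable)
  also have "\<dots> = (\<integral>\<^sup>+\<omega>. (\<Sum>i=1..m. \<Sum>j=1..n. ennreal (w \<omega> (i, j)) * f (X i \<omega>, Y j \<omega>)) \<partial>M)"
    by (intro nn_integral_cong)
       (auto simp: nn_integral_count_space_finite sum.cartesian_product intro!: sum.cong)
  finally show ?thesis .
qed

text \<open>Summing out one index replaces the weights by the constants 1/m or 1/n, so the marginals
  forget the plan and only the averaged law of the sample points remains. Stating the hypotheses for
  that average covers both fixed points, with empirical marginals, and identically distributed
  samples.\<close>

lemma mix_coupling_in_couplings:
  fixes P :: "'a::topological_space measure" and Q :: "'b::topological_space measure"
  assumes P: "sets P = sets borel" and Q: "sets Q = sets borel"
    and X: "\<And>i. i \<in> {1..m} \<Longrightarrow> X i \<in> borel_measurable M"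
    and Y: "\<And>j. j \<in> {1..n} \<Longrightarrow> Y j \<in> borel_measurable M"
    and w: "\<And>p. p \<in> {1..m} \<times> {1..n} \<Longrightarrow> (\<lambda>\<omega>. w \<omega> p) \<in> borel_measurable M"
    and plan: "\<And>\<omega>. \<omega> \<in> space M \<Longrightarrow> w \<omega> \<in> plans m n"
    and lawP: "\<And>A. A \<in> sets borel \<Longrightarrow>
      (\<integral>\<^sup>+\<omega>. (\<Sum>i=1..m. ennreal (1 / real m) * indicator A (X i \<omega>)) \<partial>M) = emeasure P A"
    and lawQ: "\<And>A. A \<in> sets borel \<Longrightarrow>
      (\<integral>\<^sup>+\<omega>. (\<Sum>j=1..n. ennreal (1 / real n) * indicator A (Y j \<omega>)) \<partial>M) = emeasure Q A"
  shows "mix_coupling M m n w X Y \<in> couplings P Q"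
proof -
  let ?K = "mix_coupling M m n w X Y"
  have sets: "sets ?K = sets (P \<Otimes>\<^sub>M Q)"
    using sets_pair_measure_cong[OF P Q] by (simp add: sets_mix_coupling)
  have "space P = UNIV" "space Q = UNIV"
    using sets_eq_imp_space_eq[OF P] sets_eq_imp_space_eq[OF Q] by auto
  hence space: "space ?K = UNIV"
    using sets_eq_imp_space_eq[OF sets] by (simp add: space_pair_measure)
  have fst: "fst \<in> measurable ?K P" and snd: "snd \<in> measurable ?K Q"
    using measurable_cong_sets[OF sets refl] by auto
  have "distr ?K P fst = P"
  proof (rule measure_eqI)
    fix A assume "A \<in> sets (distr ?K P fst)"
    hence A: "A \<in> sets borel" "A \<in> sets P" using P by auto
    have "emeasure (distr ?K P fst) A = emeasure ?K (fst -` A \<inter> space ?K)"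
      using fst A by (intro emeasure_distr)
    also have "\<dots> = (\<integral>\<^sup>+z. indicator (fst -` A \<inter> space ?K) z \<partial>?K)"
      using measurable_sets[OF fst A(2)] by simp
    also have "\<dots> = (\<integral>\<^sup>+z. indicator A (fst z) \<partial>?K)"
      by (intro nn_integral_cong) (auto simp: indicator_def)
    also have "\<dots> = (\<integral>\<^sup>+\<omega>. (\<Sum>i=1..m. \<Sum>j=1..n. ennreal (w \<omega> (i, j)) * indicator A (fst (X i \<omega>, Y j \<omega>))) \<partial>M)"
      by (rule nn_integral_mix_coupling) (use X Y w A(1) in \<open>auto\<close>)
    also have "\<dots> = (\<integral>\<^sup>+\<omega>. (\<Sum>i=1..m. ennreal (1 / real m) * indicator A (X i \<omega>)) \<partial>M)"
    proof (intro nn_integral_cong sum.cong refl)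
      fix \<omega> i assume *: "\<omega> \<in> space M" "i \<in> {1..m}"
      have "(\<Sum>j=1..n. ennreal (w \<omega> (i, j)) * indicator A (fst (X i \<omega>, Y j \<omega>)))
          = (\<Sum>j=1..n. ennreal (w \<omega> (i, j))) * indicator A (X i \<omega>)"
        by (simp add: sum_distrib_right)
      also have "(\<Sum>j=1..n. ennreal (w \<omega> (i, j))) = ennreal (1 / real m)"
        using plan[OF *(1)] *(2) by (subst sum_ennreal) (auto simp: plans_def)
      finally show "(\<Sum>j=1..n. ennreal (w \<omega> (i, j)) * indicator A (fst (X i \<omega>, Y j \<omega>)))
        = ennreal (1 / real m) * indicator A (X i \<omega>)" .
    qed
    also have "\<dots> = emeasure P A" using lawP[OF A(1)] .
    finally show "emeasure (distr ?K P fst) A = emeasure P A" .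
  qed simp
  moreover have "distr ?K Q snd = Q"
  proof (rule measure_eqI)
    fix A assume "A \<in> sets (distr ?K Q snd)"
    hence A: "A \<in> sets borel" "A \<in> sets Q" using Q by auto
    have "emeasure (distr ?K Q snd) A = emeasure ?K (snd -` A \<inter> space ?K)"
      using snd A by (intro emeasure_distr)
    also have "\<dots> = (\<integral>\<^sup>+z. indicator (snd -` A \<inter> space ?K) z \<partial>?K)"
      using measurable_sets[OF snd A(2)] by simp
    also have "\<dots> = (\<integral>\<^sup>+z. indicator A (snd z) \<partial>?K)"
      by (intro nn_integral_cong) (auto simp: indicator_def)
    also have "\<dots> = (\<integral>\<^sup>+\<omega>. (\<Sum>i=1..m. \<Sum>j=1..n. ennreal (w \<omega> (i, j)) * indicator A (snd (X i \<omega>, Y j \<omega>))) \<partial>M)"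
      by (rule nn_integral_mix_coupling) (use X Y w A(1) in \<open>auto\<close>)
    also have "\<dots> = (\<integral>\<^sup>+\<omega>. (\<Sum>j=1..n. \<Sum>i=1..m. ennreal (w \<omega> (i, j)) * indicator A (snd (X i \<omega>, Y j \<omega>))) \<partial>M)"
      by (intro nn_integral_cong sum.swap)
    also have "\<dots> = (\<integral>\<^sup>+\<omega>. (\<Sum>j=1..n. ennreal (1 / real n) * indicator A (Y j \<omega>)) \<partial>M)"
    proof (intro nn_integral_cong sum.cong refl)
      fix \<omega> j assume *: "\<omega> \<in> space M" "j \<in> {1..n}"
      have "(\<Sum>i=1..m. ennreal (w \<omega> (i, j)) * indicator A (snd (X i \<omega>, Y j \<omega>)))
          = (\<Sum>i=1..m. ennreal (w \<omega> (i, j))) * indicator A (Y j \<omega>)"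
        by (simp add: sum_distrib_right)
      also have "(\<Sum>i=1..m. ennreal (w \<omega> (i, j))) = ennreal (1 / real n)"
        using plan[OF *(1)] *(2) by (subst sum_ennreal) (auto simp: plans_def)
      finally show "(\<Sum>i=1..m. ennreal (w \<omega> (i, j)) * indicator A (snd (X i \<omega>, Y j \<omega>)))
        = ennreal (1 / real n) * indicator A (Y j \<omega>)" .
    qed
    also have "\<dots> = emeasure Q A" using lawQ[OF A(1)] .
    finally show "emeasure (distr ?K Q snd) A = emeasure Q A" .
  qed simp
  ultimately show ?thesis using sets by (simp add: couplings_def)
qed

lemma nn_integral_mix_coupling_real:
  assumes X: "\<And>i. i \<in> {1..m} \<Longrightarrow> X i \<in> borel_measurable M"
    and Y: "\<And>j. j \<in> {1..n} \<Longrightarrow> Y j \<in> borel_measurable M"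
    and w: "\<And>p. p \<in> {1..m} \<times> {1..n} \<Longrightarrow> (\<lambda>\<omega>. w \<omega> p) \<in> borel_measurable M"
    and plan: "\<And>\<omega>. \<omega> \<in> space M \<Longrightarrow> w \<omega> \<in> plans m n"
    and c: "(\<lambda>(x, y). c x y) \<in> borel_measurable (borel \<Otimes>\<^sub>M borel)" "\<And>x y. 0 \<le> c x y"
  shows "(\<integral>\<^sup>+z. ennreal (case z of (x, y) \<Rightarrow> c x y) \<partial>mix_coupling M m n w X Y)
    = (\<integral>\<^sup>+\<omega>. ennreal (plan_cost m n (\<lambda>i j. c (X i \<omega>) (Y j \<omega>)) (w \<omega>)) \<partial>M)"
proof -
  have "(\<integral>\<^sup>+z. ennreal (case z of (x, y) \<Rightarrow> c x y) \<partial>mix_coupling M m n w X Y)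
    = (\<integral>\<^sup>+\<omega>. (\<Sum>i=1..m. \<Sum>j=1..n. ennreal (w \<omega> (i, j)) * ennreal (case (X i \<omega>, Y j \<omega>) of (x, y) \<Rightarrow> c x y)) \<partial>M)"
    by (rule nn_integral_mix_coupling) (use X Y w c in auto)
  also have "\<dots> = (\<integral>\<^sup>+\<omega>. ennreal (plan_cost m n (\<lambda>i j. c (X i \<omega>) (Y j \<omega>)) (w \<omega>)) \<partial>M)"
  proof (intro nn_integral_cong)
    fix \<omega> assume "\<omega> \<in> space M"
    hence "\<And>p. 0 \<le> w \<omega> p" using plan by (auto simp: plans_def)
    thus "(\<Sum>i=1..m. \<Sum>j=1..n. ennreal (w \<omega> (i, j)) * ennreal (case (X i \<omega>, Y j \<omega>) of (x, y) \<Rightarrow> c x y))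
      = ennreal (plan_cost m n (\<lambda>i j. c (X i \<omega>) (Y j \<omega>)) (w \<omega>))"
      using c(2) by (simp add: plan_cost_def sum_nonneg flip: ennreal_mult sum_ennreal)
  qed
  finally show ?thesis .
qed

text \<open>This includes the case of an infinite integral, where both sides are 0 by
  convention.\<close>

lemma integral_case_prod_nonneg:
  assumes "sets K = sets (borel \<Otimes>\<^sub>M borel)"
    and "(\<lambda>(x, y). c x y) \<in> borel_measurable (borel \<Otimes>\<^sub>M borel)" "\<And>x y. 0 \<le> (c x y :: real)"
  shows "(\<integral>(x, y). c x y \<partial>K) = enn2real (\<integral>\<^sup>+z. ennreal (case z of (x, y) \<Rightarrow> c x y) \<partial>K)"
  using assms measurable_cong_sets[OF assms(1) refl] by (intro integral_eq_nn_integral) auto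

section \<open>Couplings of empirical measures as transport plans\<close>

lemma plan_cost_attained_by_coupling:
  fixes x :: "nat \<Rightarrow> 'a::topological_space" and y :: "nat \<Rightarrow> 'b::topological_space"
  assumes w: "w \<in> plans m n"
    and c: "(\<lambda>(x, y). c x y) \<in> borel_measurable (borel \<Otimes>\<^sub>M borel)" "\<And>x y. 0 \<le> c x y"
  shows "\<exists>K\<in>couplings (empirical m x) (empirical n y).
      (\<integral>(x, y). c x y \<partial>K) = plan_cost m n (\<lambda>i j. c (x i) (y j)) w"
proof
  \<comment> \<open>Over a one-point probability space the mixture reduces to a single discrete
    coupling with fixed atoms.\<close>
  let ?M = "return (count_space UNIV) ()"
  let ?K = "mix_coupling ?M m n (\<lambda>_. w) (\<lambda>i _. x i) (\<lambda>j _. y j)"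
  have emp: "(\<integral>\<^sup>+\<omega>. (\<Sum>i=1..N. ennreal (1 / real N) * indicator A (z i)) \<partial>?M) = emeasure (empirical N z) A"
    if "A \<in> sets borel" for A N and z :: "nat \<Rightarrow> 'c::topological_space"
  proof -
    have "(\<Sum>i=1..N. ennreal (1 / real N) * indicator A (z i)) = ennreal (1 / real N) * (\<Sum>i=1..N. indicator A (z i))"
      by (simp only: sum_distrib_left)
    also have "\<dots> = (\<Sum>i=1..N. indicator A (z i)) / of_nat N"
      by (cases "N = 0") (simp_all add: ennreal_of_nat_eq_real_of_nat divide_ennreal_def inverse_ennreal
        inverse_eq_divide mult.commute del: sum_indicator_eq_card)
    also have "\<dots> = emeasure (empirical N z) A"
      using that by (simp only: emeasure_empirical emeasure_return)
    finally show ?thesis by (simp add: nn_integral_return)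
  qed
  show "?K \<in> couplings (empirical m x) (empirical n y)"
    by (rule mix_coupling_in_couplings) (use w in \<open>auto simp only: emp sets_empirical measurable_const borel_measurable_const\<close>)
  have "0 \<le> plan_cost m n (\<lambda>i j. c (x i) (y j)) w"
    unfolding plan_cost_def using w c by (auto simp: plans_def intro!: sum_nonneg)
  thus "(\<integral>(x, y). c x y \<partial>?K) = plan_cost m n (\<lambda>i j. c (x i) (y j)) w"
    using c w by (subst integral_case_prod_nonneg[OF sets_mix_coupling])
      (auto simp: nn_integral_mix_coupling_real nn_integral_return)
qed

text \<open>A value taken at k indices contributes k equal shares of 1/k each. This converts sums
  over sample indices into sums over distinct sample points.\<close>

lemma sum_div_multiplicity:
  fixes g :: "'a \<Rightarrow> real"
  assumes "finite I"
  shows "(\<Sum>i\<in>I. g (x i) / real (card {k \<in> I. x k = x i})) = (\<Sum>u\<in>x ` I. g u)"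
proof -
  have "(\<Sum>i\<in>I. g (x i) / real (card {k \<in> I. x k = x i}))
      = (\<Sum>u\<in>x ` I. \<Sum>i\<in>{i \<in> I. x i = u}. g (x i) / real (card {k \<in> I. x k = x i}))"
    by (rule sum.image_gen[OF assms])
  also have "\<dots> = (\<Sum>u\<in>x ` I. g u)"
  proof (intro sum.cong refl)
    fix u assume "u \<in> x ` I"
    hence "0 < card {k \<in> I. x k = u}" using assms by (auto simp: card_gt_0_iff)
    thus "(\<Sum>i\<in>{i \<in> I. x i = u}. g (x i) / real (card {k \<in> I. x k = x i})) = g u"
      by simp
  qed
  finally show ?thesis .
qed

lemma measure_empirical_eq:
  assumes "A \<in> sets borel"
  shows "measure (empirical N x) A = real (card {i \<in> {1..N}. x i \<in> A}) / real N"
proof -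
  have "(\<Sum>i=1..N. emeasure (return borel (x i)) A) = ennreal (real (card {i \<in> {1..N}. x i \<in> A}))"
  proof -
    have "(\<Sum>i=1..N. emeasure (return borel (x i)) A) = (\<Sum>i=1..N. ennreal (if x i \<in> A then 1 else 0))"
      using assms by (intro sum.cong) (auto simp: indicator_def)
    also have "\<dots> = ennreal (\<Sum>i=1..N. if x i \<in> A then 1 else 0)"
      by (rule sum_ennreal) auto
    also have "(\<Sum>i=1..N. if x i \<in> A then 1 else 0) = real (card {i \<in> {1..N}. x i \<in> A})"
      by (subst sum.If_cases) (auto intro!: arg_cong[where f = card])
    finally show ?thesis .
  qed
  thus ?thesis
    using assms by (cases "N = 0") (auto simp: measure_def emeasure_empirical ennreal_of_nat_eq_real_of_nat divide_ennreal)
qed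

lemma space_empirical: "space (empirical N x) = UNIV"
  using sets_eq_imp_space_eq[OF sets_empirical[of N x]] by simp

lemma prob_space_empirical:
  assumes "1 \<le> N" shows "prob_space (empirical N x)"
proof
  show "emeasure (empirical N x) (space (empirical N x)) = 1"
    using assms by (simp add: space_empirical emeasure_empirical ennreal_of_nat_eq_real_of_nat divide_ennreal)
qed

text \<open>The T1 axiom makes the finite set of sample points closed, hence Borel.\<close>

lemma AE_empirical:
  fixes x :: "nat \<Rightarrow> 'a::t1_space"
  assumes "1 \<le> N" shows "AE u in empirical N x. u \<in> x ` {1..N}"
proof -
  interpret prob_space "empirical N x" using prob_space_empirical[OF assms] .
  have A: "x ` {1..N} \<in> sets borel" by (intro borel_closed finite_imp_closed) auto
  have "{i \<in> {1..N}. x i \<in> x ` {1..N}} = {1..N}" by auto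
  hence "prob (x ` {1..N}) = 1"
    using measure_empirical_eq[OF A, of N x] assms by simp
  thus ?thesis using A by (subst AE_in_set_eq_1) auto
qed

lemma couplings_D:
  assumes "K \<in> couplings P Q" "sets P = sets borel" "sets Q = sets borel"
  shows "sets K = sets (borel \<Otimes>\<^sub>M borel)" "fst \<in> measurable K P" "snd \<in> measurable K Q"
    "distr K P fst = P" "distr K Q snd = Q" "space K = UNIV"
proof -
  have K: "sets K = sets (P \<Otimes>\<^sub>M Q)" "distr K P fst = P" "distr K Q snd = Q"
    using assms(1) by (auto simp: couplings_def)
  show "sets K = sets (borel \<Otimes>\<^sub>M borel)" using K(1) sets_pair_measure_cong[OF assms(2,3)] by simp
  from sets_eq_imp_space_eq[OF this] show "space K = UNIV" by (simp add: space_pair_measure)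
  show "fst \<in> measurable K P" "snd \<in> measurable K Q"
    using measurable_cong_sets[OF K(1) refl] by auto
qed (use assms in \<open>auto simp: couplings_def\<close>)

lemma prob_space_coupling:
  assumes "K \<in> couplings P Q" "prob_space P"
  shows "prob_space K"
proof -
  have K: "sets K = sets (P \<Otimes>\<^sub>M Q)" "distr K P fst = P" using assms by (auto simp: couplings_def)
  have "fst \<in> measurable K P" using measurable_cong_sets[OF K(1) refl] by auto
  from prob_space_distrD[OF this] show ?thesis using K assms by simp
qed

text \<open>Sample points may coincide, so the mass that a coupling puts on a pair of points is shared
  equally among all index pairs that realise it.\<close>

lemma coupling_cost_attained_by_plan:
  fixes x :: "nat \<Rightarrow> 'a::t1_space" and y :: "nat \<Rightarrow> 'b::t1_space"
  assumes m: "1 \<le> m" and n: "1 \<le> n" and K: "K \<in> couplings (empirical m x) (empirical n y)"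
    and c: "(\<lambda>(x, y). c x y :: real) \<in> borel_measurable (borel \<Otimes>\<^sub>M borel)"
  shows "\<exists>w\<in>plans m n. (\<integral>(x, y). c x y \<partial>K) = plan_cost m n (\<lambda>i j. c (x i) (y j)) w"
proof -
  note D = couplings_D[OF K sets_empirical sets_empirical]
  interpret K: prob_space K using prob_space_coupling[OF K prob_space_empirical[OF m]] .
  let ?U = "x ` {1..m}" and ?V = "y ` {1..n}"
  define a where "a = (\<lambda>u. real (card {k \<in> {1..m}. x k = u}))"
  define b where "b = (\<lambda>v. real (card {k \<in> {1..n}. y k = v}))"
  define \<mu> where "\<mu> = (\<lambda>u v. measure K ({u} \<times> {v}))"
  define w where "w = (\<lambda>(i, j). \<mu> (x i) (y j) / (a (x i) * b (y j)))"
  have "AE z in K. fst z \<in> ?U"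
    by (rule AE_distrD[OF D(2)], unfold D(4)) (rule AE_empirical[OF m])
  moreover have "AE z in K. snd z \<in> ?V"
    by (rule AE_distrD[OF D(3)], unfold D(5)) (rule AE_empirical[OF n])
  ultimately have supp: "AE z in K. fst z \<in> ?U \<and> snd z \<in> ?V" by eventually_elim simp
  have single: "{u} \<times> {v} \<in> sets K" for u v unfolding D(1) by (intro pair_measureI) auto
  have rect: "{u} \<times> UNIV \<in> sets K" "UNIV \<times> {v} \<in> sets K" for u v unfolding D(1) by (auto intro!: pair_measureI)
  have a_eq: "measure K ({u} \<times> UNIV) = a u / real m" for u
  proof -
    have "measure K ({u} \<times> UNIV) = measure K (fst -` {u} \<inter> space K)"
      unfolding D(6) by (intro arg_cong[where f = "measure K"]) auto
    also have "\<dots> = measure (distr K (empirical m x) fst) {u}"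
      using D(2) by (intro measure_distr[symmetric]) auto
    finally show ?thesis unfolding D(4) by (simp add: measure_empirical_eq a_def)
  qed
  have b_eq: "measure K (UNIV \<times> {v}) = b v / real n" for v
  proof -
    have "measure K (UNIV \<times> {v}) = measure K (snd -` {v} \<inter> space K)"
      unfolding D(6) by (intro arg_cong[where f = "measure K"]) auto
    also have "\<dots> = measure (distr K (empirical n y) snd) {v}"
      using D(3) by (intro measure_distr[symmetric]) auto
    finally show ?thesis unfolding D(5) by (simp add: measure_empirical_eq b_def)
  qed
  have sum_a: "(\<Sum>v\<in>?V. \<mu> u v) = a u / real m" for u
  proof -
    have "(\<Sum>v\<in>?V. \<mu> u v) = measure K (\<Union>v\<in>?V. {u} \<times> {v})"
      unfolding \<mu>_def using single by (intro K.finite_measure_finite_Union[symmetric]) (auto simp: disjoint_family_on_def)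
    \<comment> \<open>The second coordinate lies in \<open>?V\<close> almost surely, so the finite
      union of atoms exhausts the strip over \<open>u\<close> up to a null set.\<close>
    also have "\<dots> = measure K ({u} \<times> UNIV)"
    proof (rule K.finite_measure_eq_AE)
      show "AE z in K. z \<in> (\<Union>v\<in>?V. {u} \<times> {v}) \<longleftrightarrow> z \<in> {u} \<times> UNIV"
        using supp by eventually_elim auto
    qed (use single rect in \<open>auto intro!: sets.finite_UN\<close>)
    finally show ?thesis by (simp add: a_eq)
  qed
  have sum_b: "(\<Sum>u\<in>?U. \<mu> u v) = b v / real n" for v
  proof -
    have "(\<Sum>u\<in>?U. \<mu> u v) = measure K (\<Union>u\<in>?U. {u} \<times> {v})"
      unfolding \<mu>_def using single by (intro K.finite_measure_finite_Union[symmetric]) (auto simp: disjoint_family_on_def)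
    also have "\<dots> = measure K (UNIV \<times> {v})"
    proof (rule K.finite_measure_eq_AE)
      show "AE z in K. z \<in> (\<Union>u\<in>?U. {u} \<times> {v}) \<longleftrightarrow> z \<in> UNIV \<times> {v}"
        using supp by eventually_elim auto
    qed (use single rect in \<open>auto intro!: sets.finite_UN\<close>)
    finally show ?thesis by (simp add: b_eq)
  qed
  have a_pos: "a (x i) \<noteq> 0" if "i \<in> {1..m}" for i
    using that by (auto simp: a_def card_eq_0_iff)
  have b_pos: "b (y j) \<noteq> 0" if "j \<in> {1..n}" for j
    using that by (auto simp: b_def card_eq_0_iff)
  have U: "(\<Sum>i=1..m. g (x i) / a (x i)) = (\<Sum>u\<in>?U. g u)" for g
    unfolding a_def by (rule sum_div_multiplicity) simp
  have V: "(\<Sum>j=1..n. g (y j) / b (y j)) = (\<Sum>v\<in>?V. g v)" for g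
    unfolding b_def by (rule sum_div_multiplicity) simp
  have "w \<in> plans m n"
    unfolding plans_def
  proof (safe)
    fix i j show "0 \<le> w (i, j)" by (auto simp: w_def \<mu>_def a_def b_def)
  next
    fix i assume i: "i \<in> {1..m}"
    have "(\<Sum>j=1..n. w (i, j)) = (\<Sum>j=1..n. (\<mu> (x i) (y j) / a (x i)) / b (y j))"
      by (simp add: w_def)
    also have "\<dots> = (\<Sum>v\<in>?V. \<mu> (x i) v / a (x i))" by (rule V)
    also have "\<dots> = 1 / real m" using sum_a[of "x i"] a_pos[OF i] by (simp flip: sum_divide_distrib)
    finally show "(\<Sum>j=1..n. w (i, j)) = 1 / real m" .
  next
    fix j assume j: "j \<in> {1..n}"
    have "(\<Sum>i=1..m. w (i, j)) = (\<Sum>i=1..m. (\<mu> (x i) (y j) / b (y j)) / a (x i))"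
      by (simp add: w_def mult.commute)
    also have "\<dots> = (\<Sum>u\<in>?U. \<mu> u (y j) / b (y j))" by (rule U)
    also have "\<dots> = 1 / real n" using sum_b[of "y j"] b_pos[OF j] by (simp flip: sum_divide_distrib)
    finally show "(\<Sum>i=1..m. w (i, j)) = 1 / real n" .
  qed
  moreover have "(\<integral>(x, y). c x y \<partial>K) = plan_cost m n (\<lambda>i j. c (x i) (y j)) w"
  proof -
    have cK: "(\<lambda>(x, y). c x y) \<in> borel_measurable K"
      using c measurable_cong_sets[OF D(1) refl] by auto
    \<comment> \<open>\<open>K\<close> is concentrated on the finite set
      \<open>?U \<times> ?V\<close>, so the cost agrees almost everywhere with a finite combination
      of indicators of atoms, which is integrable.\<close>
    have "(\<integral>(x, y). c x y \<partial>K) = (\<integral>z. (\<Sum>u\<in>?U. \<Sum>v\<in>?V. indicator ({u} \<times> {v}) z * c u v) \<partial>K)"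
    proof (rule integral_cong_AE)
      show "AE z in K. (case z of (x, y) \<Rightarrow> c x y) = (\<Sum>u\<in>?U. \<Sum>v\<in>?V. indicator ({u} \<times> {v}) z * c u v)"
        using supp
      proof eventually_elim
        case (elim z)
        obtain p q where z: "z = (p, q)" by (cases z)
        have "(\<Sum>u\<in>?U. \<Sum>v\<in>?V. indicator ({u} \<times> {v}) z * c u v)
            = (\<Sum>u\<in>?U. \<Sum>v\<in>?V. if v = q then (if u = p then c u v else 0) else 0)"
          unfolding z by (intro sum.cong refl) (auto simp: indicator_def)
        also have "\<dots> = c p q" using elim unfolding z by (simp add: sum.delta)
        finally show ?case by (simp add: z)
      qed
    next
      show "(\<lambda>z. \<Sum>u\<in>?U. \<Sum>v\<in>?V. indicator ({u} \<times> {v}) z * c u v) \<in> borel_measurable K"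
        by (intro borel_measurable_sum borel_measurable_times borel_measurable_indicator borel_measurable_const single)
    qed (rule cK)
    also have "\<dots> = (\<Sum>u\<in>?U. \<Sum>v\<in>?V. \<integral>z. indicator ({u} \<times> {v}) z * c u v \<partial>K)"
    proof -
      have int: "integrable K (\<lambda>z. indicator ({u} \<times> {v}) z * c u v)" for u v
        using single by (intro integrable_mult_left integrable_real_indicator) (auto simp: less_top[symmetric])
      show ?thesis
        by (simp only: Bochner_Integration.integral_sum Bochner_Integration.integrable_sum int)
    qed
    also have "\<dots> = (\<Sum>u\<in>?U. \<Sum>v\<in>?V. \<mu> u v * c u v)"
      using single by (simp add: \<mu>_def D(6))
    also have "\<dots> = (\<Sum>i=1..m. (\<Sum>v\<in>?V. \<mu> (x i) v * c (x i) v) / a (x i))"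
      by (rule U[symmetric])
    also have "\<dots> = (\<Sum>i=1..m. (\<Sum>j=1..n. \<mu> (x i) (y j) * c (x i) (y j) / b (y j)) / a (x i))"
      by (intro sum.cong refl arg_cong2[where f = "(/)"] V[symmetric])
    also have "\<dots> = plan_cost m n (\<lambda>i j. c (x i) (y j)) w"
      unfolding plan_cost_def w_def by (simp add: sum_divide_distrib mult.commute)
    finally show ?thesis .
  qed
  ultimately show ?thesis by blast
qed

lemma empirical_cost_eq_min_cost:
  fixes x :: "nat \<Rightarrow> 'a::t1_space" and y :: "nat \<Rightarrow> 'b::t1_space"
  assumes m: "1 \<le> m" and n: "1 \<le> n"
    and c: "(\<lambda>(x, y). c x y :: real) \<in> borel_measurable (borel \<Otimes>\<^sub>M borel)" "\<And>x y. 0 \<le> c x y"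
  shows "(INF K\<in>couplings (empirical m x) (empirical n y). \<integral>(x, y). c x y \<partial>K)
    = min_cost m n (\<lambda>i j. c (x i) (y j))"
proof -
  \<comment> \<open>Even the sets of attained costs coincide, so equality of the infima does not
    depend on either being attained.\<close>
  have "(\<lambda>K. \<integral>(x, y). c x y \<partial>K) ` couplings (empirical m x) (empirical n y)
      = plan_cost m n (\<lambda>i j. c (x i) (y j)) ` plans m n"
    using coupling_cost_attained_by_plan[OF m n _ c(1), of _ x y]
      plan_cost_attained_by_coupling[OF _ c, of _ m n x y] by (auto simp: image_iff) metis+
  thus ?thesis by (simp add: min_cost_def)
qed

text \<open>The coupling is the mixture over \<open>\<omega>\<close> of \<open>e\<close>-optimal plans. Choosing them from a countable
  dense set of plans makes the choice measurable.\<close>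

lemma optimal_cost_le_expected_empirical:
  fixes P :: "'a::t1_space measure" and Q :: "'b::t1_space measure"
  assumes M: "prob_space M" and m: "1 \<le> m" and n: "1 \<le> n"
    and P: "sets P = sets borel" and Q: "sets Q = sets borel"
    and X: "\<And>i. i \<in> {1..m} \<Longrightarrow> X i \<in> borel_measurable M" "\<And>i. i \<in> {1..m} \<Longrightarrow> distr M P (X i) = P"
    and Y: "\<And>j. j \<in> {1..n} \<Longrightarrow> Y j \<in> borel_measurable M" "\<And>j. j \<in> {1..n} \<Longrightarrow> distr M Q (Y j) = Q"
    and c: "(\<lambda>(x, y). c x y :: real) \<in> borel_measurable (borel \<Otimes>\<^sub>M borel)" "\<And>x y. 0 \<le> c x y"
    and int: "integrable M (\<lambda>\<omega>. min_cost m n (\<lambda>i j. c (X i \<omega>) (Y j \<omega>)))"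
    and e: "0 < e"
  shows "\<exists>K\<in>couplings P Q. (\<integral>(x, y). c x y \<partial>K) \<le> (\<integral>\<omega>. min_cost m n (\<lambda>i j. c (X i \<omega>) (Y j \<omega>)) \<partial>M) + e"
proof -
  interpret prob_space M by fact
  obtain t :: "nat \<Rightarrow> nat \<times> nat \<Rightarrow> real" where t: "\<And>k. t k \<in> plans m n"
    "\<And>c (e :: real). 0 < e \<Longrightarrow> \<exists>k. plan_cost m n c (t k) < min_cost m n c + e"
    by (rule dense_plans[OF m n]) blast
  define C where "C = (\<lambda>\<omega> i j. c (X i \<omega>) (Y j \<omega>))"
  have C: "(\<lambda>\<omega>. C \<omega> i j) \<in> borel_measurable M" if "i \<in> {1..m}" "j \<in> {1..n}" for i j
    unfolding C_def using measurable_compose[OF measurable_Pair[OF X(1)[OF that(1)] Y(1)[OF that(2)]] c(1)] by simp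
  have [measurable]: "(\<lambda>\<omega>. min_cost m n (C \<omega>)) \<in> borel_measurable M"
    by (rule borel_measurable_min_cost[OF m n C])
  have [measurable]: "(\<lambda>\<omega>. plan_cost m n (C \<omega>) (t k)) \<in> borel_measurable M" for k
    by (rule borel_measurable_plan_cost[OF C])
  define sel where "sel = (\<lambda>\<omega>. LEAST k. plan_cost m n (C \<omega>) (t k) < min_cost m n (C \<omega>) + e)"
  \<comment> \<open>A least index among countably many conditions, each comparing two measurable
    functions of \<omega>.\<close>
  have sel[measurable]: "sel \<in> measurable M (count_space UNIV)"
    unfolding sel_def by measurable
  have sel_less: "plan_cost m n (C \<omega>) (t (sel \<omega>)) < min_cost m n (C \<omega>) + e" for \<omega>
    unfolding sel_def using t(2)[OF e, of "C \<omega>"] by (rule LeastI_ex)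
  define w where "w = (\<lambda>\<omega>. t (sel \<omega>))"
  have w: "(\<lambda>\<omega>. w \<omega> p) \<in> borel_measurable M" for p
    unfolding w_def by measurable
  have plan: "w \<omega> \<in> plans m n" for \<omega> by (simp add: w_def t(1))
  \<comment> \<open>Supplies \<open>lawP\<close> and \<open>lawQ\<close> for the mixture: an average
    of identical laws is that law.\<close>
  have mean: "(\<integral>\<^sup>+\<omega>. (\<Sum>i=1..N. ennreal (1 / real N) * indicator A (Z i \<omega>)) \<partial>M) = emeasure R A"
    if N: "1 \<le> N" and R: "sets R = sets borel" and A: "A \<in> sets borel"
      and Z: "\<And>i. i \<in> {1..N} \<Longrightarrow> Z i \<in> borel_measurable M" "\<And>i. i \<in> {1..N} \<Longrightarrow> distr M R (Z i) = R"
    for N Z A and R :: "'z::topological_space measure"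
  proof -
    have one: "(\<integral>\<^sup>+\<omega>. ennreal (1 / real N) * indicator A (Z i \<omega>) \<partial>M) = ennreal (1 / real N) * emeasure R A"
      if i: "i \<in> {1..N}" for i
    proof -
      have Zi[measurable]: "Z i \<in> borel_measurable M" using Z i by auto
      have ZR: "Z i \<in> measurable M R" using Zi measurable_cong_sets[OF refl R] by blast
      have "(\<integral>\<^sup>+\<omega>. indicator A (Z i \<omega>) \<partial>M) = (\<integral>\<^sup>+u. indicator A u \<partial>distr M R (Z i))"
        using A R by (intro nn_integral_distr[OF ZR, symmetric]) auto
      also have "\<dots> = emeasure R A" using Z(2)[OF i] A R by simp
      finally show ?thesis using A by (subst nn_integral_cmult) auto
    qed
    have "(\<integral>\<^sup>+\<omega>. (\<Sum>i=1..N. ennreal (1 / real N) * indicator A (Z i \<omega>)) \<partial>M)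
        = (\<Sum>i=1..N. \<integral>\<^sup>+\<omega>. ennreal (1 / real N) * indicator A (Z i \<omega>) \<partial>M)"
      using Z A by (intro nn_integral_sum) auto
    also have "\<dots> = of_nat N * (ennreal (1 / real N) * emeasure R A)"
      using one by simp
    also have "\<dots> = (ennreal (real N) * ennreal (1 / real N)) * emeasure R A"
      by (simp add: ennreal_of_nat_eq_real_of_nat mult.assoc)
    also have "\<dots> = emeasure R A"
      using N by (simp flip: ennreal_mult)
    finally show ?thesis .
  qed
  let ?K = "mix_coupling M m n w X Y"
  have "?K \<in> couplings P Q"
    by (rule mix_coupling_in_couplings)
       (use P Q X Y w plan mean[OF m P _ X] mean[OF n Q _ Y] in auto)
  have nonneg: "0 \<le> min_cost m n (C \<omega>)" for \<omega>
    unfolding min_cost_def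
  proof (rule cINF_greatest)
    show "plans m n \<noteq> {}" using plan by blast
    show "0 \<le> plan_cost m n (C \<omega>) v" if "v \<in> plans m n" for v
      using that c(2) by (auto simp: plan_cost_def plans_def C_def intro!: sum_nonneg)
  qed
  have "(\<integral>\<^sup>+z. ennreal (case z of (x, y) \<Rightarrow> c x y) \<partial>?K) = (\<integral>\<^sup>+\<omega>. ennreal (plan_cost m n (C \<omega>) (w \<omega>)) \<partial>M)"
    unfolding C_def by (rule nn_integral_mix_coupling_real) (use X Y w plan c in auto)
  also have "\<dots> \<le> (\<integral>\<^sup>+\<omega>. ennreal (min_cost m n (C \<omega>) + e) \<partial>M)"
    using sel_less by (intro nn_integral_mono ennreal_leI) (auto simp: w_def intro: less_imp_le)
  also have "\<dots> = ennreal (\<integral>\<omega>. min_cost m n (C \<omega>) + e \<partial>M)"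
    using int e nonneg by (intro nn_integral_eq_integral) (auto simp: C_def intro: add_nonneg_nonneg less_imp_le)
  also have "(\<integral>\<omega>. min_cost m n (C \<omega>) + e \<partial>M) = (\<integral>\<omega>. min_cost m n (C \<omega>) \<partial>M) + e"
    using int by (simp add: C_def prob_space)
  finally have "(\<integral>\<^sup>+z. ennreal (case z of (x, y) \<Rightarrow> c x y) \<partial>?K) \<le> ennreal ((\<integral>\<omega>. min_cost m n (C \<omega>) \<partial>M) + e)" .
  moreover have "0 \<le> (\<integral>\<omega>. min_cost m n (C \<omega>) \<partial>M) + e"
    using e nonneg by (intro add_nonneg_nonneg Bochner_Integration.integral_nonneg) auto
  ultimately have "(\<integral>(x, y). c x y \<partial>?K) \<le> (\<integral>\<omega>. min_cost m n (\<lambda>i j. c (X i \<omega>) (Y j \<omega>)) \<partial>M) + e"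
    unfolding integral_case_prod_nonneg[OF sets_mix_coupling c] C_def by (intro enn2real_leI)
  with \<open>?K \<in> couplings P Q\<close> show ?thesis by blast
qed

section \<open>Scores and losses\<close>

lemma l1_norm_diff_le: "l1_norm (x - y) \<le> l1_norm x + l1_norm y"
  unfolding l1_norm_def sum.distrib[symmetric] by (intro sum_mono) auto

lemma borel_measurable_l1_norm [measurable]: "l1_norm \<in> borel_measurable borel"
  unfolding l1_norm_def by measurable

context
  fixes lam :: "'t measure" and s :: "'t \<Rightarrow> real ^ 'n \<Rightarrow> real"
  assumes sf: "score_family lam s"
begin

interpretation lam: finite_measure lam
  using sf by (simp add: score_family_def)

lemma score_measurable [measurable]: "(\<lambda>(\<theta>, x). s \<theta> x) \<in> borel_measurable (lam \<Otimes>\<^sub>M borel)"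
  using sf by (simp add: score_family_def)

text \<open>The assumptions control only the score at 0 and the increments, so the score at
  \<open>x\<close> is split accordingly.\<close>

lemma integrable_score: "integrable lam (\<lambda>\<theta>. s \<theta> x)"
proof -
  have m[measurable]: "(\<lambda>\<theta>. s \<theta> x) \<in> borel_measurable lam" for x by measurable
  obtain L where L: "0 \<le> L" "\<And>x y. (\<integral>\<^sup>+\<theta>. ennreal \<bar>s \<theta> x - s \<theta> y\<bar> \<partial>lam) \<le> ennreal (L * l1_norm (x - y))"
    using sf by (auto simp: score_family_def)
  have "integrable lam (\<lambda>\<theta>. s \<theta> 0)"
    using sf by (intro integrableI_bounded) (auto simp: score_family_def)
  moreover have "integrable lam (\<lambda>\<theta>. s \<theta> x - s \<theta> 0)"
    using L(2)[of x 0] by (intro integrableI_bounded) (auto simp: order.strict_trans1)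
  ultimately have "integrable lam (\<lambda>\<theta>. s \<theta> 0 + (s \<theta> x - s \<theta> 0))" by (rule Bochner_Integration.integrable_add)
  thus ?thesis by simp
qed

lemma loss_nonneg: "0 \<le> loss lam s x y"
  unfolding loss_def by (intro Bochner_Integration.integral_nonneg) auto

lemma borel_measurable_loss: "(\<lambda>(x, y). loss lam s x y) \<in> borel_measurable (borel \<Otimes>\<^sub>M borel)"
  unfolding loss_def by measurable

lemma borel_measurable_agg_score: "agg_score lam s \<in> borel_measurable borel"
  unfolding agg_score_def by measurable

lemma integrable_pos_part: "integrable lam (\<lambda>\<theta>. max (s \<theta> x - s \<theta> y) 0)"
  using integrable_score by (intro integrable_max) auto

text \<open>From max t 0 - max (-t) 0 = t. The antisymmetric part of the loss thus splits into a
  function of \<open>x\<close> minus the same function of \<open>y\<close>, so its integral depends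
  on the marginals and not on the coupling.\<close>

lemma loss_diff: "loss lam s x y - loss lam s y x = agg_score lam s x - agg_score lam s y"
proof -
  have "loss lam s x y - loss lam s y x = (\<integral>\<theta>. max (s \<theta> x - s \<theta> y) 0 - max (s \<theta> y - s \<theta> x) 0 \<partial>lam)"
    unfolding loss_def using integrable_pos_part by simp
  also have "\<dots> = (\<integral>\<theta>. s \<theta> x - s \<theta> y \<partial>lam)"
    by (intro Bochner_Integration.integral_cong) auto
  finally show ?thesis using integrable_score by (simp add: agg_score_def)
qed

text \<open>Both quantities are dominated by the integral of the absolute score increment. These
  linear bounds make the aggregate score integrable under laws with finite first moment, and the
  loss integrable under couplings of such laws.\<close>

lemma score_lipschitz:
  obtains L where "0 \<le> L" "\<And>x y. loss lam s x y \<le> L * l1_norm (x - y)"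
    "\<And>x y. \<bar>agg_score lam s x - agg_score lam s y\<bar> \<le> L * l1_norm (x - y)"
proof -
  obtain L where L: "0 \<le> L" "\<And>x y. (\<integral>\<^sup>+\<theta>. ennreal \<bar>s \<theta> x - s \<theta> y\<bar> \<partial>lam) \<le> ennreal (L * l1_norm (x - y))"
    using sf by (auto simp: score_family_def)
  have L1: "(\<integral>\<theta>. \<bar>s \<theta> x - s \<theta> y\<bar> \<partial>lam) \<le> L * l1_norm (x - y)" for x y
  proof -
    have "ennreal (\<integral>\<theta>. \<bar>s \<theta> x - s \<theta> y\<bar> \<partial>lam) = (\<integral>\<^sup>+\<theta>. ennreal \<bar>s \<theta> x - s \<theta> y\<bar> \<partial>lam)"
      using integrable_score by (intro nn_integral_eq_integral[symmetric]) auto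
    \<comment> \<open>\<open>ennreal\<close> sends negative numbers to 0, so returning to a real
      inequality requires a nonnegative right-hand side.\<close>
    moreover have "0 \<le> L * l1_norm (x - y)" using L(1) by (auto simp: l1_norm_def intro!: sum_nonneg mult_nonneg_nonneg)
    ultimately show ?thesis using L(2)[of x y] by (metis ennreal_le_iff)
  qed
  have "loss lam s x y \<le> (\<integral>\<theta>. \<bar>s \<theta> x - s \<theta> y\<bar> \<partial>lam)" for x y
    unfolding loss_def using integrable_pos_part integrable_score by (intro integral_mono) auto
  moreover have "\<bar>agg_score lam s x - agg_score lam s y\<bar> \<le> (\<integral>\<theta>. \<bar>s \<theta> x - s \<theta> y\<bar> \<partial>lam)" for x y
  proof -
    have "agg_score lam s x - agg_score lam s y = (\<integral>\<theta>. s \<theta> x - s \<theta> y \<partial>lam)"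
      unfolding agg_score_def using integrable_score by simp
    thus ?thesis using integral_abs_bound[of lam "\<lambda>\<theta>. s \<theta> x - s \<theta> y"] by simp
  qed
  ultimately show thesis using L1 L(1) that[of L] by (meson order_trans)
qed

lemma integrable_agg_score:
  assumes "prob_space P" "sets P = sets borel" "integrable P l1_norm"
  shows "integrable P (agg_score lam s)"
proof -
  interpret prob_space P by fact
  obtain L where L: "0 \<le> L" "\<And>x y. \<bar>agg_score lam s x - agg_score lam s y\<bar> \<le> L * l1_norm (x - y)"
    by (rule score_lipschitz) blast
  have m: "agg_score lam s \<in> borel_measurable P"
    using borel_measurable_agg_score measurable_cong_sets[OF assms(2) refl] by blast
  show ?thesis
  proof (rule Bochner_Integration.integrable_bound)
    show "integrable P (\<lambda>x. \<bar>agg_score lam s 0\<bar> + L * l1_norm x)" using assms by simp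
    show "AE x in P. norm (agg_score lam s x) \<le> norm (\<bar>agg_score lam s 0\<bar> + L * l1_norm x)"
      using L(2)[of _ 0] by (intro AE_I2) (smt (verit) diff_zero real_norm_def)
  qed (fact m)
qed

lemma integrable_loss_coupling:
  assumes P: "sets P = sets borel" "integrable P l1_norm" and Q: "sets Q = sets borel" "integrable Q l1_norm"
    and K: "K \<in> couplings P Q"
  shows "integrable K (\<lambda>(x, y). loss lam s x y)" "integrable K (\<lambda>(x, y). loss lam s y x)"
proof -
  note sets = couplings_D(1,4,5)[OF K P(1) Q(1)] and fst = couplings_D(2)[OF K P(1) Q(1)]
    and snd = couplings_D(3)[OF K P(1) Q(1)]
  obtain L where L: "0 \<le> L" "\<And>x y. loss lam s x y \<le> L * l1_norm (x - y)"
    by (rule score_lipschitz) blast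
  have "integrable K (\<lambda>z. l1_norm (fst z))" 
    using integrable_distr_eq[OF fst, of l1_norm] P sets by (simp add: measurable_cong_sets[OF P(1) refl])
  moreover have "integrable K (\<lambda>z. l1_norm (snd z))"
    using integrable_distr_eq[OF snd, of l1_norm] Q sets by (simp add: measurable_cong_sets[OF Q(1) refl])
  ultimately have int: "integrable K (\<lambda>z. L * (l1_norm (fst z) + l1_norm (snd z)))" by simp
  have le: "loss lam s x y \<le> L * (l1_norm x + l1_norm y)" for x y
    using L(2)[of x y] mult_left_mono[OF l1_norm_diff_le[of x y] L(1)] by simp
  have le': "loss lam s y x \<le> L * (l1_norm x + l1_norm y)" for x y
    using le[of y x] by (simp add: add.commute)
  have m: "(\<lambda>(x, y). loss lam s x y) \<in> borel_measurable K" "(\<lambda>(x, y). loss lam s y x) \<in> borel_measurable K"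
    unfolding measurable_cong_sets[OF sets(1) refl]
    using borel_measurable_loss measurable_compose[OF measurable_pair_swap' borel_measurable_loss]
    by (auto simp: case_prod_unfold)
  show "integrable K (\<lambda>(x, y). loss lam s x y)"
    by (rule Bochner_Integration.integrable_bound[OF int m(1)])
       (use le loss_nonneg in \<open>auto intro!: AE_I2 order_trans[OF _ abs_ge_self]\<close>)
  show "integrable K (\<lambda>(x, y). loss lam s y x)"
    by (rule Bochner_Integration.integrable_bound[OF int m(2)])
       (use le' loss_nonneg in \<open>auto intro!: AE_I2 order_trans[OF _ abs_ge_self]\<close>)
qed

lemma coupling_loss_diff:
  assumes P: "prob_space P" "sets P = sets borel" "integrable P l1_norm"
    and Q: "prob_space Q" "sets Q = sets borel" "integrable Q l1_norm"
    and K: "K \<in> couplings P Q"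
  shows "(\<integral>(x, y). loss lam s y x \<partial>K) = (\<integral>(x, y). loss lam s x y \<partial>K)
    + ((\<integral>y. agg_score lam s y \<partial>Q) - (\<integral>x. agg_score lam s x \<partial>P))"
proof -
  note int = integrable_loss_coupling[OF P(2,3) Q(2,3) K]
  note sets = couplings_D(4,5)[OF K P(2) Q(2)] and fst = couplings_D(2)[OF K P(2) Q(2)]
    and snd = couplings_D(3)[OF K P(2) Q(2)]
  have mP: "agg_score lam s \<in> borel_measurable P" and mQ: "agg_score lam s \<in> borel_measurable Q"
    using borel_measurable_agg_score measurable_cong_sets[OF P(2) refl] measurable_cong_sets[OF Q(2) refl] by blast+
  have iP: "integrable K (\<lambda>z. agg_score lam s (fst z))"
    using integrable_distr_eq[OF fst mP] integrable_agg_score[OF P] sets by simp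
  have iQ: "integrable K (\<lambda>z. agg_score lam s (snd z))"
    using integrable_distr_eq[OF snd mQ] integrable_agg_score[OF Q] sets by simp
  have "(\<integral>(x, y). loss lam s y x \<partial>K) - (\<integral>(x, y). loss lam s x y \<partial>K)
      = (\<integral>z. (case z of (x, y) \<Rightarrow> loss lam s y x) - (case z of (x, y) \<Rightarrow> loss lam s x y) \<partial>K)"
    by (rule Bochner_Integration.integral_diff[symmetric, OF int(2) int(1)])
  also have "\<dots> = (\<integral>z. agg_score lam s (snd z) - agg_score lam s (fst z) \<partial>K)"
    by (intro Bochner_Integration.integral_cong) (auto simp: loss_diff)
  also have "\<dots> = (\<integral>z. agg_score lam s (snd z) \<partial>K) - (\<integral>z. agg_score lam s (fst z) \<partial>K)"
    using iP iQ by simp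
  also have "(\<integral>z. agg_score lam s (snd z) \<partial>K) = (\<integral>y. agg_score lam s y \<partial>Q)"
    using integral_distr[OF snd mQ] sets by simp
  also have "(\<integral>z. agg_score lam s (fst z) \<partial>K) = (\<integral>x. agg_score lam s x \<partial>P)"
    using integral_distr[OF fst mP] sets by simp
  finally show ?thesis by simp
qed

end

text \<open>The deficit is affine in the tolerance, running from \<open>L\<close> at 0 to
  \<open>- d\<close> at 1. If \<open>L\<close> is positive and \<open>d\<close> nonnegative its root
  is \<open>L / (L + d)\<close>; if \<open>L\<close> is positive and \<open>d\<close> negative it is
  positive on the whole interval, and the infimum is that of the empty set. The closed form shows
  that a finite infimum is attained, and it makes measurability in the sample evident.\<close>

lemma gamma_upper_eq:
  fixes lam s DP DQ NP NQ \<delta> x y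
  defines "L \<equiv> loss_upper lam s DP DQ NP NQ \<delta> x y" and "d \<equiv> gap_lower lam s DP DQ NP NQ \<delta> x y"
  shows "gamma_upper lam s DP DQ NP NQ \<delta> x y
    = (if L \<le> 0 then 0 else if 0 \<le> d then ereal (L / (L + d)) else \<infinity>)"
proof -
  have eq: "gamma_upper lam s DP DQ NP NQ \<delta> x y = Inf (ereal ` {\<gamma>\<in>{0..1}. (1 - \<gamma>) * L - \<gamma> * d \<le> 0})"
    by (simp add: gamma_upper_def deficit_upper_def L_def d_def)
  consider "L \<le> 0" | "0 < L" "0 \<le> d" | "0 < L" "d < 0" by linarith
  thus ?thesis
  proof cases
    case 1
    have "Inf (ereal ` {\<gamma>\<in>{0..1}. (1 - \<gamma>) * L - \<gamma> * d \<le> 0}) = 0"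
      using 1 by (intro antisym Inf_lower Inf_greatest) (auto simp: zero_ereal_def intro!: image_eqI[of _ _ 0])
    thus ?thesis using 1 eq by simp
  next
    case 2
    have "{\<gamma>\<in>{0..1}. (1 - \<gamma>) * L - \<gamma> * d \<le> 0} = {L / (L + d)..1}"
      using 2 by (auto simp: field_simps intro: order_trans[of 0 "L / (L + d)"])
    moreover have "Inf (ereal ` {L / (L + d)..1}) = ereal (L / (L + d))"
      using 2 by (intro antisym Inf_lower Inf_greatest) auto
    ultimately show ?thesis using 2 eq by simp
  next
    case 3
    have "0 < (1 - \<gamma>) * L - \<gamma> * d" if "0 \<le> \<gamma>" "\<gamma> \<le> 1" for \<gamma>
    proof (cases "\<gamma> = 0")
      case False
      hence "\<gamma> * d < 0" using 3 that by (simp add: mult_pos_neg)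
      moreover have "0 \<le> (1 - \<gamma>) * L" using 3 that by simp
      ultimately show ?thesis by linarith
    qed (use 3 in simp)
    hence empty: "{\<gamma>\<in>{0..1}. (1 - \<gamma>) * L - \<gamma> * d \<le> 0} = {}" by force
    show ?thesis unfolding eq empty using 3 by (simp add: top_ereal_def)
  qed
qed

text \<open>In a complete linear order such a set is the closed or the open ray starting at its
  infimum. The empty set is the open ray above the top element.\<close>

lemma up_closed_in_borel:
  fixes U :: "'a::{complete_linorder, linorder_topology} set"
  assumes "\<And>x y. x \<in> U \<Longrightarrow> x \<le> y \<Longrightarrow> y \<in> U"
  shows "U \<in> sets borel"
proof (cases "Inf U \<in> U")
  case True
  hence "U = {Inf U..}" using assms by (auto intro: Inf_lower)
  thus ?thesis by (metis atLeast_borel)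
next
  case False
  have "U = {Inf U<..}"
  proof (safe)
    fix x assume x: "x \<in> U"
    hence "Inf U \<le> x" by (rule Inf_lower)
    moreover have "Inf U \<noteq> x" using x False by blast
    ultimately show "Inf U < x" by simp
  next
    fix x assume "Inf U < x"
    then obtain u where "u \<in> U" "u < x" by (auto simp: Inf_less_iff)
    thus "x \<in> U" using assms by (blast intro: less_imp_le)
  qed
  thus ?thesis by (metis greaterThan_borel)
qed

text \<open>The deterministic half of the argument: a single coupling that meets the loss bound
  witnesses dominance at every tolerance from the upper one on, because its reverse loss exceeds its
  loss by the mean gap.\<close>

lemma csd_of_bounds:
  fixes P Q :: "(real ^ 'n) measure"
  assumes sf: "score_family lam s"
    and P: "prob_space P" "sets P = sets borel" "integrable P l1_norm"
    and Q: "prob_space Q" "sets Q = sets borel" "integrable Q l1_norm"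
    and K: "K \<in> couplings P Q"
    and L: "(\<integral>(x, y). loss lam s x y \<partial>K) \<le> loss_upper lam s DP DQ NP NQ \<delta> x y"
    and d: "gap_lower lam s DP DQ NP NQ \<delta> x y
      \<le> (\<integral>y. agg_score lam s y \<partial>Q) - (\<integral>x. agg_score lam s x \<partial>P)"
  shows "gamma_star lam s P Q \<le> gamma_upper lam s DP DQ NP NQ \<delta> x y"
    and "gamma_upper lam s DP DQ NP NQ \<delta> x y \<le> ereal \<gamma> \<Longrightarrow> csd lam s \<gamma> P Q"
proof -
  let ?L = "loss_upper lam s DP DQ NP NQ \<delta> x y" and ?d = "gap_lower lam s DP DQ NP NQ \<delta> x y"
  let ?g = "gamma_upper lam s DP DQ NP NQ \<delta> x y"
  let ?LK = "\<integral>(x, y). loss lam s x y \<partial>K" and ?GK = "\<integral>(x, y). loss lam s y x \<partial>K"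
  have GK: "?GK = ?LK + ((\<integral>y. agg_score lam s y \<partial>Q) - (\<integral>x. agg_score lam s x \<partial>P))"
    by (rule coupling_loss_diff[OF sf P Q K])
  \<comment> \<open>Nonnegativity of the reverse loss is what lets the tolerance grow from its
    smallest value to \<gamma>.\<close>
  have GK0: "0 \<le> ?GK"
    using loss_nonneg[OF sf] by (intro Bochner_Integration.integral_nonneg) auto
  \<comment> \<open>The deficit inequality is needed at the upper tolerance itself, not merely near
    it. The witness is 0, or the root of the affine deficit.\<close>
  have attained: "\<exists>g0. ?g = ereal g0 \<and> 0 \<le> g0 \<and> g0 \<le> 1 \<and> (1 - g0) * ?L - g0 * ?d \<le> 0" if fin: "?g < \<infinity>"
  proof (cases "?L \<le> 0")
    case True
    thus ?thesis by (intro exI[of _ 0]) (simp add: gamma_upper_eq)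
  next
    case False
    hence "0 \<le> ?d" using fin by (auto simp: gamma_upper_eq split: if_splits)
    thus ?thesis using False
      by (intro exI[of _ "?L / (?L + ?d)"]) (auto simp: gamma_upper_eq field_simps)
  qed
  have csd: "csd lam s \<gamma> P Q" if le: "?g \<le> ereal \<gamma>" for \<gamma>
  proof -
    have "?g < \<infinity>" using le by (auto simp: less_le_not_le)
    then obtain g0 where g0: "?g = ereal g0" "0 \<le> g0" "g0 \<le> 1" "(1 - g0) * ?L - g0 * ?d \<le> 0"
      using attained by blast
    have "(1 - g0) * ?LK \<le> (1 - g0) * ?L" using L g0 by (intro mult_left_mono) auto
    also have "\<dots> \<le> g0 * ?d" using g0 by simp
    also have "\<dots> \<le> g0 * (?GK - ?LK)" using d g0 unfolding GK by (intro mult_left_mono) auto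
    finally have "?LK \<le> g0 * ?GK" by (simp add: algebra_simps)
    also have "\<dots> \<le> \<gamma> * ?GK" using le g0 GK0 by (intro mult_right_mono) auto
    finally show ?thesis using K unfolding csd_def by blast
  qed
  show "gamma_upper lam s DP DQ NP NQ \<delta> x y \<le> ereal \<gamma> \<Longrightarrow> csd lam s \<gamma> P Q" by (rule csd)
  show "gamma_star lam s P Q \<le> ?g"
  proof (cases "?g < \<infinity>")
    case True
    then obtain g0 where g0: "?g = ereal g0" "0 \<le> g0" "g0 \<le> 1" using attained by blast
    hence "csd lam s g0 P Q" using csd by simp
    thus ?thesis unfolding gamma_star_def g0(1) using g0 by (intro Inf_lower) auto
  qed simp
qed

section \<open>Validity of the certificate\<close>

lemma sum_fun_upd_diff:
  fixes g :: "'a \<Rightarrow> real"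
  assumes "finite I" "i \<in> I"
  shows "(\<Sum>k\<in>I. g ((x(i := u)) k)) - (\<Sum>k\<in>I. g (x k)) = g u - g (x i)"
proof -
  have "(\<Sum>k\<in>I. g ((x(i := u)) k)) - (\<Sum>k\<in>I. g (x k)) = (\<Sum>k\<in>I. if k = i then g u - g (x i) else 0)"
    unfolding sum_subtractf[symmetric] by (intro sum.cong) auto
  thus ?thesis using assms by simp
qed

lemma abs_average_le:
  fixes g :: "nat \<Rightarrow> real"
  assumes "1 \<le> N" "\<And>k. k \<in> {1..N} \<Longrightarrow> \<bar>g k\<bar> \<le> b"
  shows "\<bar>(\<Sum>k=1..N. g k) / real N\<bar> \<le> b"
proof -
  have "\<bar>\<Sum>k=1..N. g k\<bar> \<le> (\<Sum>k=1..N. \<bar>g k\<bar>)" by (rule sum_abs)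
  also have "\<dots> \<le> real N * b" using sum_bounded_above[of "{1..N}" "\<lambda>k. \<bar>g k\<bar>" b] assms by simp
  finally show ?thesis using assms(1) by (simp add: field_simps)
qed

locale csd_sampling =
  fixes P Q :: "(real ^ 'n) measure" and DP DQ :: "(real ^ 'n) set"
    and lam :: "'t measure" and s :: "'t \<Rightarrow> real ^ 'n \<Rightarrow> real"
    and M :: "'w measure" and X Y :: "nat \<Rightarrow> 'w \<Rightarrow> real ^ 'n"
    and NP NQ :: nat and \<delta> :: real
  assumes P: "prob_space P" "sets P = sets borel" "integrable P l1_norm"
    and Q: "prob_space Q" "sets Q = sets borel" "integrable Q l1_norm"
    and DP: "measure P DP = 1" and DQ: "measure Q DQ = 1"
    and sf: "score_family lam s"
    and bdd: "bdd_above (loss_diffs_P lam s DP DQ)" "bdd_above (loss_diffs_Q lam s DP DQ)"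
      "bdd_above (score_diffs lam s DP)" "bdd_above (score_diffs lam s DQ)"
    and M: "prob_space M"
    and NP: "1 \<le> NP" and NQ: "1 \<le> NQ"
    and X: "iid_sample M NP X P" and Y: "iid_sample M NQ Y Q"
    and XY: "indep_samples M NP X P NQ Y Q"
    and \<delta>: "0 < \<delta>" "\<delta> < 1"
begin

sublocale M: prob_space M by (rule M)

abbreviation "L_hat \<omega> \<equiv> min_cost NP NQ (\<lambda>i j. loss lam s (X i \<omega>) (Y j \<omega>))"

abbreviation "gap \<equiv> (\<integral>y. agg_score lam s y \<partial>Q) - (\<integral>x. agg_score lam s x \<partial>P)"

lemma opt_loss_hat_eq: "opt_loss_hat lam s NP NQ x y = min_cost NP NQ (\<lambda>i j. loss lam s (x i) (y j))"
  unfolding opt_loss_hat_def opt_loss_def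
  by (rule empirical_cost_eq_min_cost[OF NP NQ borel_measurable_loss[OF sf] loss_nonneg[OF sf]])

lemma X_meas: "i \<in> {1..NP} \<Longrightarrow> X i \<in> borel_measurable M"
  and Y_meas: "j \<in> {1..NQ} \<Longrightarrow> Y j \<in> borel_measurable M"
  using iid_sample_measurable[OF M X] iid_sample_measurable[OF M Y]
    measurable_cong_sets[OF refl P(2)] measurable_cong_sets[OF refl Q(2)] by blast+

lemma X_distr: "i \<in> {1..NP} \<Longrightarrow> distr M P (X i) = P"
  and Y_distr: "j \<in> {1..NQ} \<Longrightarrow> distr M Q (Y j) = Q"
  using X Y by (auto simp: iid_sample_def)

lemma AE_DP: "AE x in P. x \<in> DP" and AE_DQ: "AE y in Q. y \<in> DQ"
proof -
  have "DP \<in> sets P" "DQ \<in> sets Q" using DP DQ by (metis measure_notin_sets zero_neq_one)+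
  thus "AE x in P. x \<in> DP" "AE y in Q. y \<in> DQ"
    using DP DQ prob_space.AE_in_set_eq_1[OF P(1)] prob_space.AE_in_set_eq_1[OF Q(1)] by auto
qed

lemma AE_samples: "AE \<omega> in M. (\<forall>i\<in>{1..NP}. X i \<omega> \<in> DP) \<and> (\<forall>j\<in>{1..NQ}. Y j \<omega> \<in> DQ)"
  using iid_sample_AE[OF M X AE_DP] iid_sample_AE[OF M Y AE_DQ] by eventually_elim blast

lemma DP_DQ_nonempty: "\<exists>x0 y0. x0 \<in> DP \<and> y0 \<in> DQ"
  using DP DQ by (metis all_not_in_conv measure_empty zero_neq_one)

lemma osc_loss:
  assumes "x \<in> DP" "x' \<in> DP" "y \<in> DQ"
  shows "\<bar>loss lam s x y - loss lam s x' y\<bar> \<le> Sup (loss_diffs_P lam s DP DQ)"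
  using assms by (intro cSup_upper bdd) (auto simp: loss_diffs_P_def)

lemma osc_loss':
  assumes "x \<in> DP" "y \<in> DQ" "y' \<in> DQ"
  shows "\<bar>loss lam s x y - loss lam s x y'\<bar> \<le> Sup (loss_diffs_Q lam s DP DQ)"
  using assms by (intro cSup_upper bdd) (auto simp: loss_diffs_Q_def)

lemma osc_score:
  assumes "x \<in> DP" "x' \<in> DP"
  shows "\<bar>agg_score lam s x - agg_score lam s x'\<bar> \<le> Sup (score_diffs lam s DP)"
  using assms by (intro cSup_upper bdd) (auto simp: score_diffs_def)

lemma osc_score':
  assumes "y \<in> DQ" "y' \<in> DQ"
  shows "\<bar>agg_score lam s y - agg_score lam s y'\<bar> \<le> Sup (score_diffs lam s DQ)"
  using assms by (intro cSup_upper bdd) (auto simp: score_diffs_def)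

section \<open>Concentration of the empirical optimal loss\<close>

lemma L_hat_meas: "L_hat \<in> borel_measurable M"
proof (rule borel_measurable_min_cost[OF NP NQ])
  fix i j assume "i \<in> {1..NP}" "j \<in> {1..NQ}"
  thus "(\<lambda>\<omega>. loss lam s (X i \<omega>) (Y j \<omega>)) \<in> borel_measurable M"
    using measurable_compose[OF measurable_Pair[OF X_meas Y_meas] borel_measurable_loss[OF sf]] by simp
qed

lemma sample_component_meas:
  shows "i \<in> {1..NP} \<Longrightarrow> (\<lambda>z. fst z i) \<in> borel_measurable ((\<Pi>\<^sub>M i\<in>{1..NP}. P) \<Otimes>\<^sub>M (\<Pi>\<^sub>M j\<in>{1..NQ}. Q))"
    and "j \<in> {1..NQ} \<Longrightarrow> (\<lambda>z. snd z j) \<in> borel_measurable ((\<Pi>\<^sub>M i\<in>{1..NP}. P) \<Otimes>\<^sub>M (\<Pi>\<^sub>M j\<in>{1..NQ}. Q))"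
proof -
  assume "i \<in> {1..NP}"
  from measurable_compose[OF measurable_fst measurable_component_singleton[OF this, of "\<lambda>_. P"]]
  show "(\<lambda>z. fst z i) \<in> borel_measurable ((\<Pi>\<^sub>M i\<in>{1..NP}. P) \<Otimes>\<^sub>M (\<Pi>\<^sub>M j\<in>{1..NQ}. Q))"
    using measurable_cong_sets[OF refl P(2)] by blast
next
  assume "j \<in> {1..NQ}"
  from measurable_compose[OF measurable_snd measurable_component_singleton[OF this, of "\<lambda>_. Q"]]
  show "(\<lambda>z. snd z j) \<in> borel_measurable ((\<Pi>\<^sub>M i\<in>{1..NP}. P) \<Otimes>\<^sub>M (\<Pi>\<^sub>M j\<in>{1..NQ}. Q))"
    using measurable_cong_sets[OF refl Q(2)] by blast
qed

text \<open>The radius solves exp(-2 t^2 / C) = \<delta>/2 for t. The level is halved because two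
  bounds share the failure probability.\<close>

lemma tail_at_radius:
  assumes "0 < C" "t = sqrt (ln (2 / \<delta>) / 2 * C)"
  shows "0 < t" "exp (- 2 * t\<^sup>2 / C) = \<delta> / 2"
proof -
  have ln: "0 < ln (2 / \<delta>)" using \<delta> by (intro ln_gt_zero) (auto simp: field_simps)
  thus "0 < t" using assms by simp
  have "t\<^sup>2 = ln (2 / \<delta>) / 2 * C" using assms ln by (simp add: less_imp_le)
  hence "- 2 * t\<^sup>2 / C = - ln (2 / \<delta>)" using assms(1) by (simp add: field_simps)
  also have "\<dots> = ln (\<delta> / 2)" using \<delta> by (simp add: ln_div)
  finally show "exp (- 2 * t\<^sup>2 / C) = \<delta> / 2" using \<delta> by simp
qed

text \<open>N coordinates, each with influence c/N, enter the tail bound through the sum of squared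
  influences. This is the origin of the terms c^2 / N in the radii.\<close>

lemma scaled_square: "1 \<le> N \<Longrightarrow> real N * (c / real N)\<^sup>2 = c\<^sup>2 / real N"
  by (simp add: power2_eq_square)

lemma coupling_near_expected_L_hat:
  assumes "0 < e"
  shows "\<exists>K\<in>couplings P Q. (\<integral>(x, y). loss lam s x y \<partial>K) \<le> (\<integral>\<omega>. L_hat \<omega> \<partial>M) + e"
proof (rule optimal_cost_le_expected_empirical[OF M NP NQ P(2) Q(2) X_meas X_distr Y_meas Y_distr
      borel_measurable_loss[OF sf] loss_nonneg[OF sf] _ assms])
  obtain x0 y0 where xy: "x0 \<in> DP" "y0 \<in> DQ" using DP_DQ_nonempty by blast
  \<comment> \<open>Moving \<open>x\<close> to \<open>x0\<close> and then \<open>y\<close> to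
    \<open>y0\<close> changes the loss by at most the two oscillations, which bounds it on the
    supports.\<close>
  define b where "b = loss lam s x0 y0 + Sup (loss_diffs_P lam s DP DQ) + Sup (loss_diffs_Q lam s DP DQ)"
  have b: "0 \<le> loss lam s x y \<and> loss lam s x y \<le> b" if "x \<in> DP" "y \<in> DQ" for x y
    using osc_loss[OF that(1) xy(1) that(2)] osc_loss'[OF xy(1) that(2) xy(2)] loss_nonneg[OF sf, of x y]
    by (auto simp: b_def abs_le_iff)
  show "integrable M L_hat"
  proof (rule M.integrable_const_bound[OF _ L_hat_meas])
    show "AE \<omega> in M. norm (L_hat \<omega>) \<le> b"
      using AE_samples
    proof eventually_elim
      case (elim \<omega>)
      have "0 \<le> loss lam s (X i \<omega>) (Y j \<omega>) \<and> loss lam s (X i \<omega>) (Y j \<omega>) \<le> b"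
        if "i \<in> {1..NP}" "j \<in> {1..NQ}" for i j using b elim that by blast
      from min_cost_bounds[OF NP NQ this] show ?case by simp
    qed
  qed
qed

text \<open>An exceptional set is exhibited because the event that some coupling meets the bound
  quantifies over couplings, and its measurability is not evident.\<close>

lemma loss_upper_valid:
  "\<exists>B\<in>sets M. measure M B \<le> \<delta> / 2 \<and> (\<forall>\<omega>\<in>space M - B. \<exists>K\<in>couplings P Q.
     (\<integral>(x, y). loss lam s x y \<partial>K) \<le> loss_upper lam s DP DQ NP NQ \<delta> (\<lambda>i. X i \<omega>) (\<lambda>j. Y j \<omega>))"
proof -
  obtain x0 y0 where xy: "x0 \<in> DP" "y0 \<in> DQ" using DP_DQ_nonempty by blast
  define cP where "cP = Sup (loss_diffs_P lam s DP DQ)"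
  define cQ where "cQ = Sup (loss_diffs_Q lam s DP DQ)"
  define C where "C = cP\<^sup>2 / real NP + cQ\<^sup>2 / real NQ"
  define t where "t = sqrt (ln (2 / \<delta>) / 2 * C)"
  have upper: "loss_upper lam s DP DQ NP NQ \<delta> (\<lambda>i. X i \<omega>) (\<lambda>j. Y j \<omega>) = L_hat \<omega> + t" for \<omega>
    unfolding loss_upper_def opt_loss_hat_eq t_def C_def cP_def cQ_def ..
  have "0 \<le> C" by (auto simp: C_def)
  then consider "0 < C" | "C = 0" by linarith
  thus ?thesis
  proof cases
    case 1
    note t = tail_at_radius[OF 1 t_def]
    \<comment> \<open>The sign turns the upper tail of the concentration inequality into the lower
      tail of the empirical loss: the bound can fail only if that loss falls short of its mean by at
      least \<open>t\<close>.\<close>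
    define f where "f = (\<lambda>z. - min_cost NP NQ (\<lambda>i j. loss lam s (fst z i) (snd z j)))"
    define Z where "Z = (\<lambda>\<omega>. (\<lambda>i\<in>{1..NP}. X i \<omega>, \<lambda>j\<in>{1..NQ}. Y j \<omega>))"
    have fZ: "f (Z \<omega>) = - L_hat \<omega>" for \<omega>
      unfolding f_def Z_def by (auto intro!: min_cost_cong)
    have "measure M {\<omega> \<in> space M. t \<le> f (Z \<omega>) - (\<integral>\<omega>. f (Z \<omega>) \<partial>M)} \<le> exp (- 2 * t\<^sup>2 / C)"
    proof (rule mcdiarmid_two_samples[where c = "cP / real NP" and d = "cQ / real NQ"
          and B = "loss lam s x0 y0 + cP + cQ"])
      show "f \<in> borel_measurable ((\<Pi>\<^sub>M i\<in>{1..NP}. P) \<Otimes>\<^sub>M (\<Pi>\<^sub>M j\<in>{1..NQ}. Q))"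
        unfolding f_def
      proof (intro borel_measurable_uminus borel_measurable_min_cost[OF NP NQ])
        fix i j assume "i \<in> {1..NP}" "j \<in> {1..NQ}"
        from measurable_compose[OF measurable_Pair[OF sample_component_meas(1)[OF this(1)]
            sample_component_meas(2)[OF this(2)]] borel_measurable_loss[OF sf]]
        show "(\<lambda>z. loss lam s (fst z i) (snd z j)) \<in> borel_measurable ((\<Pi>\<^sub>M i\<in>{1..NP}. P) \<Otimes>\<^sub>M (\<Pi>\<^sub>M j\<in>{1..NQ}. Q))"
          by simp
      qed
    next
      fix x y assume xy': "x \<in> {1..NP} \<rightarrow>\<^sub>E DP" "y \<in> {1..NQ} \<rightarrow>\<^sub>E DQ"
      have "0 \<le> loss lam s (x i) (y j) \<and> loss lam s (x i) (y j) \<le> loss lam s x0 y0 + cP + cQ"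
        if "i \<in> {1..NP}" "j \<in> {1..NQ}" for i j
      proof -
        have "x i \<in> DP" "y j \<in> DQ" using xy' that by auto
        thus ?thesis
          using osc_loss[of "x i" x0 "y j"] osc_loss'[of x0 "y j" y0] xy loss_nonneg[OF sf, of "x i" "y j"]
          by (auto simp: cP_def cQ_def abs_le_iff)
      qed
      from min_cost_bounds[OF NP NQ this]
      show "\<bar>f (x, y)\<bar> \<le> loss lam s x0 y0 + cP + cQ" by (simp add: f_def)
    next
      fix x y i u assume x: "x \<in> {1..NP} \<rightarrow>\<^sub>E DP" and y: "y \<in> {1..NQ} \<rightarrow>\<^sub>E DQ" and i: "i \<in> {1..NP}" and u: "u \<in> DP"
      have "\<bar>min_cost NP NQ (\<lambda>k j. loss lam s ((x(i := u)) k) (y j)) - min_cost NP NQ (\<lambda>k j. loss lam s (x k) (y j))\<bar>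
        \<le> cP / real NP"
      proof (rule min_cost_row_change[OF NP NQ i])
        fix j assume "j \<in> {1..NQ}"
        thus "\<bar>loss lam s ((x(i := u)) i) (y j) - loss lam s (x i) (y j)\<bar> \<le> cP"
          using osc_loss[OF u PiE_mem[OF x i] PiE_mem[OF y]] by (simp add: cP_def)
      qed auto
      thus "\<bar>f (x(i := u), y) - f (x, y)\<bar> \<le> cP / real NP" by (simp add: f_def abs_minus_commute)
    next
      fix x y j v assume x: "x \<in> {1..NP} \<rightarrow>\<^sub>E DP" and y: "y \<in> {1..NQ} \<rightarrow>\<^sub>E DQ" and j: "j \<in> {1..NQ}" and v: "v \<in> DQ"
      have "\<bar>min_cost NP NQ (\<lambda>i k. loss lam s (x i) ((y(j := v)) k)) - min_cost NP NQ (\<lambda>i k. loss lam s (x i) (y k))\<bar>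
        \<le> cQ / real NQ"
      proof (rule min_cost_col_change[OF NP NQ j])
        fix i assume "i \<in> {1..NP}"
        thus "\<bar>loss lam s (x i) ((y(j := v)) j) - loss lam s (x i) (y j)\<bar> \<le> cQ"
          using osc_loss'[OF PiE_mem[OF x] v PiE_mem[OF y j]] by (simp add: cQ_def)
      qed auto
      thus "\<bar>f (x, y(j := v)) - f (x, y)\<bar> \<le> cQ / real NQ" by (simp add: f_def abs_minus_commute)
    next
      show "C = real NP * (cP / real NP)\<^sup>2 + real NQ * (cQ / real NQ)\<^sup>2"
        unfolding scaled_square[OF NP] scaled_square[OF NQ] by (rule C_def)
    qed (fact M P(1) Q(1) NP NQ X Y XY DP DQ 1 t(1) Z_def)+
    hence small: "measure M {\<omega> \<in> space M. t \<le> (\<integral>\<omega>. L_hat \<omega> \<partial>M) - L_hat \<omega>} \<le> \<delta> / 2"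
      unfolding fZ t(2) by simp
    show ?thesis
    proof (intro bexI[of _ "{\<omega> \<in> space M. t \<le> (\<integral>\<omega>. L_hat \<omega> \<partial>M) - L_hat \<omega>}"] conjI ballI)
      fix \<omega> assume "\<omega> \<in> space M - {\<omega> \<in> space M. t \<le> (\<integral>\<omega>. L_hat \<omega> \<partial>M) - L_hat \<omega>}"
      \<comment> \<open>Off the exceptional set the inequality is strict, and its slack is the
        amount by which a coupling may exceed the mean empirical loss.\<close>
      hence "0 < L_hat \<omega> + t - (\<integral>\<omega>. L_hat \<omega> \<partial>M)" by auto
      from coupling_near_expected_L_hat[OF this]
      show "\<exists>K\<in>couplings P Q. (\<integral>(x, y). loss lam s x y \<partial>K)
          \<le> loss_upper lam s DP DQ NP NQ \<delta> (\<lambda>i. X i \<omega>) (\<lambda>j. Y j \<omega>)"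
        unfolding upper by simp
    qed (use small L_hat_meas in \<open>auto\<close>)
  next
    \<comment> \<open>The radius is 0 and the strict tail bound is void, but the loss is constant on the supports,
      so every coupling will do.\<close>
    case 2
    have "cP\<^sup>2 / real NP = 0" "cQ\<^sup>2 / real NQ = 0"
      using 2 unfolding C_def by (simp_all add: add_nonneg_eq_0_iff)
    hence c0: "cP = 0" "cQ = 0" using NP NQ by auto
    have const: "loss lam s x y = loss lam s x0 y0" if "x \<in> DP" "y \<in> DQ" for x y
      using osc_loss[OF that(1) xy(1) that(2)] osc_loss'[OF xy(1) that(2) xy(2)] c0
      by (auto simp: cP_def cQ_def)
    \<comment> \<open>The value 1 is arbitrary; it merely yields some coupling.\<close>
    obtain K where K: "K \<in> couplings P Q" using coupling_near_expected_L_hat[of 1] by auto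
    note D = couplings_D[OF K P(2) Q(2)]
    interpret K: prob_space K using prob_space_coupling[OF K P(1)] .
    have "AE z in K. fst z \<in> DP" by (rule AE_distrD[OF D(2)], unfold D(4)) (rule AE_DP)
    moreover have "AE z in K. snd z \<in> DQ" by (rule AE_distrD[OF D(3)], unfold D(5)) (rule AE_DQ)
    ultimately have "AE z in K. (case z of (x, y) \<Rightarrow> loss lam s x y) = loss lam s x0 y0"
      by eventually_elim (auto simp: const)
    hence "(\<integral>(x, y). loss lam s x y \<partial>K) = (\<integral>z. loss lam s x0 y0 \<partial>K)"
      using integrable_loss_coupling(1)[OF sf P(2,3) Q(2,3) K] by (intro integral_cong_AE) auto
    hence LK: "(\<integral>(x, y). loss lam s x y \<partial>K) = loss lam s x0 y0" by (simp add: K.prob_space)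
    from AE_E[OF AE_samples] obtain B where B: "B \<in> sets M" "emeasure M B = 0"
      "{\<omega> \<in> space M. \<not> ((\<forall>i\<in>{1..NP}. X i \<omega> \<in> DP) \<and> (\<forall>j\<in>{1..NQ}. Y j \<omega> \<in> DQ))} \<subseteq> B"
      by blast
    show ?thesis
    proof (intro bexI[of _ B] conjI ballI)
      show "measure M B \<le> \<delta> / 2" using B \<delta> by (simp add: measure_def)
      fix \<omega> assume "\<omega> \<in> space M - B"
      hence "X i \<omega> \<in> DP" "Y j \<omega> \<in> DQ" if "i \<in> {1..NP}" "j \<in> {1..NQ}" for i j using B(3) that by blast+
      hence "loss lam s x0 y0 \<le> loss lam s (X i \<omega>) (Y j \<omega>) \<and> loss lam s (X i \<omega>) (Y j \<omega>) \<le> loss lam s x0 y0"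
        if "i \<in> {1..NP}" "j \<in> {1..NQ}" for i j using const that by auto
      from min_cost_bounds(1)[OF NP NQ this] have "loss lam s x0 y0 \<le> L_hat \<omega>" .
      thus "\<exists>K\<in>couplings P Q. (\<integral>(x, y). loss lam s x y \<partial>K)
          \<le> loss_upper lam s DP DQ NP NQ \<delta> (\<lambda>i. X i \<omega>) (\<lambda>j. Y j \<omega>)"
        unfolding upper using K LK 2 by (intro bexI[of _ K]) (auto simp: t_def)
    qed (fact B)
  qed
qed

section \<open>Concentration of the empirical mean gap\<close>

lemma agg_score_sample:
  shows "i \<in> {1..NP} \<Longrightarrow> integrable M (\<lambda>\<omega>. agg_score lam s (X i \<omega>))"
    and "i \<in> {1..NP} \<Longrightarrow> (\<integral>\<omega>. agg_score lam s (X i \<omega>) \<partial>M) = (\<integral>x. agg_score lam s x \<partial>P)"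
    and "j \<in> {1..NQ} \<Longrightarrow> integrable M (\<lambda>\<omega>. agg_score lam s (Y j \<omega>))"
    and "j \<in> {1..NQ} \<Longrightarrow> (\<integral>\<omega>. agg_score lam s (Y j \<omega>) \<partial>M) = (\<integral>y. agg_score lam s y \<partial>Q)"
proof -
  have mP: "agg_score lam s \<in> borel_measurable P" and mQ: "agg_score lam s \<in> borel_measurable Q"
    using borel_measurable_agg_score[OF sf] measurable_cong_sets[OF P(2) refl] measurable_cong_sets[OF Q(2) refl] by blast+
  {
    assume i: "i \<in> {1..NP}"
    note Xi = iid_sample_measurable[OF M X i]
    show "integrable M (\<lambda>\<omega>. agg_score lam s (X i \<omega>))"
      using integrable_distr_eq[OF Xi mP] integrable_agg_score[OF sf P] unfolding X_distr[OF i] by simp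
    show "(\<integral>\<omega>. agg_score lam s (X i \<omega>) \<partial>M) = (\<integral>x. agg_score lam s x \<partial>P)"
      using integral_distr[OF Xi mP] unfolding X_distr[OF i] by simp
  next
    assume j: "j \<in> {1..NQ}"
    note Yj = iid_sample_measurable[OF M Y j]
    show "integrable M (\<lambda>\<omega>. agg_score lam s (Y j \<omega>))"
      using integrable_distr_eq[OF Yj mQ] integrable_agg_score[OF sf Q] unfolding Y_distr[OF j] by simp
    show "(\<integral>\<omega>. agg_score lam s (Y j \<omega>) \<partial>M) = (\<integral>y. agg_score lam s y \<partial>Q)"
      using integral_distr[OF Yj mQ] unfolding Y_distr[OF j] by simp
  }
qed

lemma gap_hat_meas: "(\<lambda>\<omega>. mean_gap_hat lam s NP NQ (\<lambda>i. X i \<omega>) (\<lambda>j. Y j \<omega>)) \<in> borel_measurable M"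
  unfolding mean_gap_hat_def using agg_score_sample(1,3)
  by (intro borel_measurable_diff borel_measurable_divide borel_measurable_sum borel_measurable_const
      borel_measurable_integrable) auto

lemma expectation_gap_hat: "(\<integral>\<omega>. mean_gap_hat lam s NP NQ (\<lambda>i. X i \<omega>) (\<lambda>j. Y j \<omega>) \<partial>M) = gap"
proof -
  have "(\<integral>\<omega>. mean_gap_hat lam s NP NQ (\<lambda>i. X i \<omega>) (\<lambda>j. Y j \<omega>) \<partial>M)
      = (\<integral>\<omega>. (\<Sum>j=1..NQ. agg_score lam s (Y j \<omega>)) \<partial>M) / real NQ - (\<integral>\<omega>. (\<Sum>i=1..NP. agg_score lam s (X i \<omega>)) \<partial>M) / real NP"
    unfolding mean_gap_hat_def using agg_score_sample(1,3)
    by (subst Bochner_Integration.integral_diff) (auto intro!: integrable_divide Bochner_Integration.integrable_sum)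
  also have "(\<integral>\<omega>. (\<Sum>j=1..NQ. agg_score lam s (Y j \<omega>)) \<partial>M) = (\<Sum>j=1..NQ. \<integral>y. agg_score lam s y \<partial>Q)"
    using agg_score_sample(3,4) by (subst Bochner_Integration.integral_sum) (auto intro!: sum.cong)
  also have "(\<integral>\<omega>. (\<Sum>i=1..NP. agg_score lam s (X i \<omega>)) \<partial>M) = (\<Sum>i=1..NP. \<integral>x. agg_score lam s x \<partial>P)"
    using agg_score_sample(1,2) by (subst Bochner_Integration.integral_sum) (auto intro!: sum.cong)
  finally show ?thesis using NP NQ by simp
qed

text \<open>The empirical gap is an unbiased estimate of \<open>gap\<close>, so one-sided
  concentration around its mean is already the claim. The relevant tail is the upper one, which is
  why no sign change occurs here.\<close>

lemma gap_lower_valid: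
  "\<exists>B\<in>sets M. measure M B \<le> \<delta> / 2 \<and> (\<forall>\<omega>\<in>space M - B.
     gap_lower lam s DP DQ NP NQ \<delta> (\<lambda>i. X i \<omega>) (\<lambda>j. Y j \<omega>) \<le> gap)"
proof -
  obtain x0 y0 where xy: "x0 \<in> DP" "y0 \<in> DQ" using DP_DQ_nonempty by blast
  define cP where "cP = Sup (score_diffs lam s DP)"
  define cQ where "cQ = Sup (score_diffs lam s DQ)"
  define C where "C = cP\<^sup>2 / real NP + cQ\<^sup>2 / real NQ"
  define t where "t = sqrt (ln (2 / \<delta>) / 2 * C)"
  let ?D = "\<lambda>\<omega>. mean_gap_hat lam s NP NQ (\<lambda>i. X i \<omega>) (\<lambda>j. Y j \<omega>)"
  have lower: "gap_lower lam s DP DQ NP NQ \<delta> (\<lambda>i. X i \<omega>) (\<lambda>j. Y j \<omega>) = ?D \<omega> - t" for \<omega>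
    unfolding gap_lower_def t_def C_def cP_def cQ_def ..
  have "0 \<le> C" by (auto simp: C_def)
  then consider "0 < C" | "C = 0" by linarith
  thus ?thesis
  proof cases
    case 1
    note t = tail_at_radius[OF 1 t_def]
    define f where "f = (\<lambda>z. mean_gap_hat lam s NP NQ (fst z) (snd z))"
    define Z where "Z = (\<lambda>\<omega>. (\<lambda>i\<in>{1..NP}. X i \<omega>, \<lambda>j\<in>{1..NQ}. Y j \<omega>))"
    have fZ: "f (Z \<omega>) = ?D \<omega>" for \<omega>
      unfolding f_def Z_def mean_gap_hat_def by simp
    have "measure M {\<omega> \<in> space M. t \<le> f (Z \<omega>) - (\<integral>\<omega>. f (Z \<omega>) \<partial>M)} \<le> exp (- 2 * t\<^sup>2 / C)"
    proof (rule mcdiarmid_two_samples[where c = "cP / real NP" and d = "cQ / real NQ"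
          and B = "(\<bar>agg_score lam s y0\<bar> + cQ) + (\<bar>agg_score lam s x0\<bar> + cP)"])
      show "f \<in> borel_measurable ((\<Pi>\<^sub>M i\<in>{1..NP}. P) \<Otimes>\<^sub>M (\<Pi>\<^sub>M j\<in>{1..NQ}. Q))"
        unfolding f_def mean_gap_hat_def
        by (intro borel_measurable_diff borel_measurable_divide borel_measurable_sum borel_measurable_const
            measurable_compose[OF sample_component_meas(1) borel_measurable_agg_score[OF sf]]
            measurable_compose[OF sample_component_meas(2) borel_measurable_agg_score[OF sf]])
    next
      fix x y assume xy': "x \<in> {1..NP} \<rightarrow>\<^sub>E DP" "y \<in> {1..NQ} \<rightarrow>\<^sub>E DQ"
      have "\<bar>(\<Sum>j=1..NQ. agg_score lam s (y j)) / real NQ\<bar> \<le> \<bar>agg_score lam s y0\<bar> + cQ"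
      proof (rule abs_average_le[OF NQ])
        fix j assume "j \<in> {1..NQ}"
        hence "y j \<in> DQ" using xy' by auto
        from osc_score'[OF this xy(2)] show "\<bar>agg_score lam s (y j)\<bar> \<le> \<bar>agg_score lam s y0\<bar> + cQ"
          by (auto simp: cQ_def)
      qed
      moreover have "\<bar>(\<Sum>i=1..NP. agg_score lam s (x i)) / real NP\<bar> \<le> \<bar>agg_score lam s x0\<bar> + cP"
      proof (rule abs_average_le[OF NP])
        fix i assume "i \<in> {1..NP}"
        hence "x i \<in> DP" using xy' by auto
        from osc_score[OF this xy(1)] show "\<bar>agg_score lam s (x i)\<bar> \<le> \<bar>agg_score lam s x0\<bar> + cP"
          by (auto simp: cP_def)
      qed
      ultimately show "\<bar>f (x, y)\<bar> \<le> (\<bar>agg_score lam s y0\<bar> + cQ) + (\<bar>agg_score lam s x0\<bar> + cP)"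
        unfolding f_def mean_gap_hat_def fst_conv snd_conv by linarith
    next
      fix x y i u assume x: "x \<in> {1..NP} \<rightarrow>\<^sub>E DP" and i: "i \<in> {1..NP}" and u: "u \<in> DP"
      have "f (x(i := u), y) - f (x, y)
          = - (((\<Sum>k=1..NP. agg_score lam s ((x(i := u)) k)) - (\<Sum>k=1..NP. agg_score lam s (x k))) / real NP)"
        unfolding f_def mean_gap_hat_def fst_conv snd_conv by (simp add: diff_divide_distrib)
      also have "\<dots> = - ((agg_score lam s u - agg_score lam s (x i)) / real NP)"
        using sum_fun_upd_diff[of "{1..NP}" i "agg_score lam s" x u] i by simp
      finally have "\<bar>f (x(i := u), y) - f (x, y)\<bar> = \<bar>agg_score lam s u - agg_score lam s (x i)\<bar> / real NP"
        by simp
      also have "\<dots> \<le> cP / real NP"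
        using osc_score[OF u PiE_mem[OF x i]] by (intro divide_right_mono) (auto simp: cP_def)
      finally show "\<bar>f (x(i := u), y) - f (x, y)\<bar> \<le> cP / real NP" .
    next
      fix x y j v assume y: "y \<in> {1..NQ} \<rightarrow>\<^sub>E DQ" and j: "j \<in> {1..NQ}" and v: "v \<in> DQ"
      have "f (x, y(j := v)) - f (x, y)
          = ((\<Sum>k=1..NQ. agg_score lam s ((y(j := v)) k)) - (\<Sum>k=1..NQ. agg_score lam s (y k))) / real NQ"
        unfolding f_def mean_gap_hat_def fst_conv snd_conv by (simp add: diff_divide_distrib)
      also have "\<dots> = (agg_score lam s v - agg_score lam s (y j)) / real NQ"
        using sum_fun_upd_diff[of "{1..NQ}" j "agg_score lam s" y v] j by simp
      finally have "\<bar>f (x, y(j := v)) - f (x, y)\<bar> = \<bar>agg_score lam s v - agg_score lam s (y j)\<bar> / real NQ"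
        by simp
      also have "\<dots> \<le> cQ / real NQ"
        using osc_score'[OF v PiE_mem[OF y j]] by (intro divide_right_mono) (auto simp: cQ_def)
      finally show "\<bar>f (x, y(j := v)) - f (x, y)\<bar> \<le> cQ / real NQ" .
    next
      show "C = real NP * (cP / real NP)\<^sup>2 + real NQ * (cQ / real NQ)\<^sup>2"
        unfolding scaled_square[OF NP] scaled_square[OF NQ] by (rule C_def)
    qed (fact M P(1) Q(1) NP NQ X Y XY DP DQ 1 t(1) Z_def)+
    hence small: "measure M {\<omega> \<in> space M. t \<le> ?D \<omega> - gap} \<le> \<delta> / 2"
      unfolding fZ t(2) expectation_gap_hat .
    show ?thesis
      by (rule bexI[of _ "{\<omega> \<in> space M. t \<le> ?D \<omega> - gap}"])
         (use small gap_hat_meas in \<open>auto simp: lower\<close>)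
  next
    case 2
    have "cP\<^sup>2 / real NP = 0" "cQ\<^sup>2 / real NQ = 0"
      using 2 unfolding C_def by (simp_all add: add_nonneg_eq_0_iff)
    hence c0: "cP = 0" "cQ = 0" using NP NQ by auto
    \<comment> \<open>With radius 0 the scores are constant on each support, so the empirical gap is
      almost surely constant and therefore equal to its expectation.\<close>
    have "AE \<omega> in M. ?D \<omega> = agg_score lam s y0 - agg_score lam s x0"
      using AE_samples
    proof eventually_elim
      case (elim \<omega>)
      have "(\<Sum>j=1..NQ. agg_score lam s (Y j \<omega>)) = (\<Sum>j=1..NQ. agg_score lam s y0)"
        using elim osc_score'[OF _ xy(2)] c0 by (intro sum.cong refl) (auto simp: cQ_def)
      moreover have "(\<Sum>i=1..NP. agg_score lam s (X i \<omega>)) = (\<Sum>i=1..NP. agg_score lam s x0)"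
        using elim osc_score[OF _ xy(1)] c0 by (intro sum.cong refl) (auto simp: cP_def)
      ultimately show ?case using NP NQ by (simp add: mean_gap_hat_def)
    qed
    moreover from this have "(\<integral>\<omega>. ?D \<omega> \<partial>M) = agg_score lam s y0 - agg_score lam s x0"
      using gap_hat_meas by (subst integral_cong_AE[where g = "\<lambda>_. agg_score lam s y0 - agg_score lam s x0"])
        (auto simp: M.prob_space)
    ultimately have "AE \<omega> in M. ?D \<omega> \<le> gap" using expectation_gap_hat by auto
    then obtain B where B: "B \<in> sets M" "emeasure M B = 0" "{\<omega> \<in> space M. \<not> ?D \<omega> \<le> gap} \<subseteq> B"
      by (auto elim!: AE_E)
    show ?thesis
      by (rule bexI[of _ B]) (use B \<delta> 2 in \<open>auto simp: measure_def lower t_def\<close>)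
  qed
qed

section \<open>Measurability of the event and the union bound\<close>

lemma gamma_upper_meas:
  "(\<lambda>\<omega>. gamma_upper lam s DP DQ NP NQ \<delta> (\<lambda>i. X i \<omega>) (\<lambda>j. Y j \<omega>)) \<in> borel_measurable M"
proof -
  have [measurable]: "(\<lambda>\<omega>. loss_upper lam s DP DQ NP NQ \<delta> (\<lambda>i. X i \<omega>) (\<lambda>j. Y j \<omega>)) \<in> borel_measurable M"
    unfolding loss_upper_def opt_loss_hat_eq using L_hat_meas by measurable
  have [measurable]: "(\<lambda>\<omega>. gap_lower lam s DP DQ NP NQ \<delta> (\<lambda>i. X i \<omega>) (\<lambda>j. Y j \<omega>)) \<in> borel_measurable M"
    unfolding gap_lower_def using gap_hat_meas by measurable
  show ?thesis unfolding gamma_upper_eq by measurable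
qed

text \<open>The event is the preimage under \<^const>\<open>gamma_upper\<close> of an up-closed set of tolerances,
  whence it is measurable.\<close>

lemma certificate_valid:
  "1 - \<delta> \<le> measure M {\<omega> \<in> space M.
     let \<gamma>u = gamma_upper lam s DP DQ NP NQ \<delta> (\<lambda>i. X i \<omega>) (\<lambda>j. Y j \<omega>)
     in gamma_star lam s P Q \<le> \<gamma>u \<and>
        (\<gamma>u < \<infinity> \<longrightarrow> (\<forall>\<gamma>::real. \<gamma>u \<le> ereal \<gamma> \<and> \<gamma> \<le> 1 \<longrightarrow> csd lam s \<gamma> P Q))}"
proof -
  let ?g = "\<lambda>\<omega>. gamma_upper lam s DP DQ NP NQ \<delta> (\<lambda>i. X i \<omega>) (\<lambda>j. Y j \<omega>)"
  define U where "U = {g. gamma_star lam s P Q \<le> g \<and>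
        (g < \<infinity> \<longrightarrow> (\<forall>\<gamma>::real. g \<le> ereal \<gamma> \<and> \<gamma> \<le> 1 \<longrightarrow> csd lam s \<gamma> P Q))}"
  have "U \<in> sets borel"
  proof (rule up_closed_in_borel)
    fix g h assume g: "g \<in> U" and le: "g \<le> h"
    show "h \<in> U"
      \<comment> \<open>Raising the tolerance weakens the bound on \<open>gamma_star\<close> and
        shrinks the range of \<gamma> in the second condition.\<close>
      using g le unfolding U_def by (auto intro: order_trans dest: le_less_trans)
  qed
  hence W: "{\<omega> \<in> space M. ?g \<omega> \<in> U} \<in> sets M"
    using measurable_sets[OF gamma_upper_meas, of U] by (simp add: vimage_def Int_def conj_commute)
  obtain B1 where B1: "B1 \<in> sets M" "measure M B1 \<le> \<delta> / 2"
    "\<And>\<omega>. \<omega> \<in> space M - B1 \<Longrightarrow> \<exists>K\<in>couplings P Q.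
     (\<integral>(x, y). loss lam s x y \<partial>K) \<le> loss_upper lam s DP DQ NP NQ \<delta> (\<lambda>i. X i \<omega>) (\<lambda>j. Y j \<omega>)"
    using loss_upper_valid by blast
  obtain B2 where B2: "B2 \<in> sets M" "measure M B2 \<le> \<delta> / 2"
    "\<And>\<omega>. \<omega> \<in> space M - B2 \<Longrightarrow> gap_lower lam s DP DQ NP NQ \<delta> (\<lambda>i. X i \<omega>) (\<lambda>j. Y j \<omega>) \<le> gap"
    using gap_lower_valid by blast
  \<comment> \<open>Union bound: the two exceptional sets of measure at most \<delta>/2 together
    cost at most \<delta>.\<close>
  have "measure M (B1 \<union> B2) \<le> measure M B1 + measure M B2"
    using B1(1) B2(1) by (rule measure_Un_le)
  hence "1 - \<delta> \<le> 1 - measure M (B1 \<union> B2)" using B1(2) B2(2) by linarith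
  also have "\<dots> = measure M (space M - (B1 \<union> B2))"
    using B1(1) B2(1) by (subst M.prob_compl) auto
  also have "\<dots> \<le> measure M {\<omega> \<in> space M. ?g \<omega> \<in> U}"
  proof (rule M.finite_measure_mono[OF _ W], safe)
    fix \<omega> assume \<omega>: "\<omega> \<in> space M" "\<omega> \<notin> B1" "\<omega> \<notin> B2"
    then obtain K where K: "K \<in> couplings P Q"
      "(\<integral>(x, y). loss lam s x y \<partial>K) \<le> loss_upper lam s DP DQ NP NQ \<delta> (\<lambda>i. X i \<omega>) (\<lambda>j. Y j \<omega>)"
      using B1(3)[of \<omega>] by blast
    have gap: "gap_lower lam s DP DQ NP NQ \<delta> (\<lambda>i. X i \<omega>) (\<lambda>j. Y j \<omega>) \<le> gap"
      using B2(3)[of \<omega>] \<omega> by blast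
    show "?g \<omega> \<in> U"
      unfolding U_def using csd_of_bounds[OF sf P Q K gap] by blast
  qed
  finally show ?thesis by (simp add: U_def Let_def)
qed

end

theorem corollary4p2:
  fixes P Q :: "(real ^ 'n) measure"
    and D DP DQ :: "(real ^ 'n) set"
    and lam :: "'t measure" and s :: "'t \<Rightarrow> real ^ 'n \<Rightarrow> real"
    and M :: "'w measure" and X Y :: "nat \<Rightarrow> 'w \<Rightarrow> real ^ 'n"
    and NP NQ :: nat and \<delta> :: real
  assumes "D \<in> sets borel" and "D \<noteq> {}"
    and "prob_space P" and "sets P = sets borel"
    and "prob_space Q" and "sets Q = sets borel"
    and "measure P D = 1" and "measure Q D = 1"
    and "integrable P l1_norm" and "integrable Q l1_norm"
    and "DP \<subseteq> D" and "DQ \<subseteq> D"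
    and "measure P DP = 1" and "measure Q DQ = 1"
    and "score_family lam s"
    and "bdd_above (loss_diffs_P lam s DP DQ)"
    and "bdd_above (loss_diffs_Q lam s DP DQ)"
    and "bdd_above (score_diffs lam s DP)"
    and "bdd_above (score_diffs lam s DQ)"
    and "prob_space M"
    and "1 \<le> NP" and "1 \<le> NQ"
    and "iid_sample M NP X P" and "iid_sample M NQ Y Q"
    and "indep_samples M NP X P NQ Y Q"
    and "0 < \<delta>" and "\<delta> < 1"
  shows "1 - \<delta> \<le> measure M {\<omega> \<in> space M.
           let \<gamma>u = gamma_upper lam s DP DQ NP NQ \<delta> (\<lambda>i. X i \<omega>) (\<lambda>j. Y j \<omega>)
           in gamma_star lam s P Q \<le> \<gamma>u \<and>
              (\<gamma>u < \<infinity> \<longrightarrow> (\<forall>\<gamma>::real. \<gamma>u \<le> ereal \<gamma> \<and> \<gamma> \<le> 1 \<longrightarrow> csd lam s \<gamma> P Q))}"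
proof -
  interpret csd_sampling P Q DP DQ lam s M X Y NP NQ \<delta>
    using assms by (intro csd_sampling.intro) auto
  show ?thesis by (rule certificate_valid)
qed

end
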